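(* Let $\mathcal{C}$ be a fusion category with pivotal structure $a:\mathrm{id}_{\mathcal{C}}\to(-)^{**}$. (i) There exists a pivotal structure $\overline{a}:\mathrm{id}_{\mathcal{C}}\to(-)^{**}$ for $\mathcal{C}$ such that the morphisms $(\overline{a}_{{}^{**}x})^{-1}:x\to{}^{**}x$ are defined by $$\mathrm{tr}^{L}_{c}\bigl(g\circ(\mathrm{id}_d\otimes(\overline{a}_{{}^{**}x})^{-1})\circ f\bigr)=\mathrm{tr}^{L}_{d}\bigl((\mathrm{id}_d\otimes\mathrm{ev}'_x)\circ((f\circ g)\otimes\mathrm{id}_{{}^{*}x})\circ(\mathrm{id}_d\otimes\mathrm{coev}'_{{}^{*}x})\bigr)$$ for all objects $c,d,x$ and all $f\in\mathrm{Hom}(c,d\otimes x)$ and $g\in\mathrm{Hom}(d\otimes{}^{**}x,c)$, where $\mathrm{tr}^{L}$ is the left trace with respect to $a$. (ii) The dimension of an object $x$ with respect to the pivotal structure $\overline{a}$ is equal to the dimension of ${}^{*}x$ with respect to $a$. (iii) $\overline{a}=a$ if and only if $a$ is spherical. (iv) $\overline{\overline{a}}=a$.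
   Context: A fusion category is a semisimple, rigid, monoidal $\mathbb{C}$-linear abelian category with finite-dimensional Hom spaces, tensor product bilinear on morphisms, simple unit $1$ and finitely many isomorphism classes of simple objects; it is treated as strict. The right dual of $c$ is $c^{*}$ with $\mathrm{ev}_c:c^{*}\otimes c\to1$, $\mathrm{coev}_c:1\to c\otimes c^{*}$; the left dual is ${}^{*}c$ with $\mathrm{ev}'_c:c\otimes{}^{*}c\to1$, $\mathrm{coev}'_c:1\to{}^{*}c\otimes c$. Canonical isomorphisms $({}^{*}c)^{*}\cong c\cong{}^{*}(c^{*})$ are treated as identities, so $({}^{**}x)^{**}=x$. A pivotal structure is a monoidal natural isomorphism $a:\mathrm{id}_{\mathcal{C}}\to(-)^{**}$. The left trace of $f\in\mathrm{End}(c)$ is $\mathrm{tr}^{L}_c(f)=\mathrm{ev}_c\circ(a_{{}^{*}c}\otimes f)\circ\mathrm{coev}'_c\in\mathrm{End}(1)=\mathbb{C}$, and the right trace is $\mathrm{ev}_{c^{*}}\circ((a_c\circ f)\otimes\mathrm{id}_{c^{*}})\circ\mathrm{coev}_c$. The dimension of $c$ (with respect to $a$) is $\mathrm{tr}^{L}_c(\mathrm{id}_c)$. The pivotal structure is spherical if left and right traces agree for all endomorphisms. *)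

theory Defs
  imports Complex_Main "HOL-Library.FuncSet"
begin

text \<open>
  The data of a strict monoidal \<open>\<complex>\<close>-linear category with chosen left and right duals. All morphisms
  live in one ambient complex vector space \<open>'m\<close> (for instance the direct sum of all Hom spaces), of
  which the Hom spaces are subspaces, so that the linear algebra of the library applies. A
  morphism therefore does not determine its domain and codomain; these are passed explicitly where
  they are needed. The operations are only meaningful on objects and on composable morphisms.
\<close>

record ('o, 'm) tensor_data =
  Ob :: "'o set"
  Hom :: "'o \<Rightarrow> 'o \<Rightarrow> 'm set"
  Idm :: "'o \<Rightarrow> 'm"  (\<open>id\<index>\<close>)
  Comp :: "'m \<Rightarrow> 'm \<Rightarrow> 'm"  (infixr \<open>\<cdot>\<index>\<close> 70)
  Scale :: "complex \<Rightarrow> 'm \<Rightarrow> 'm"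
  Unit :: 'o  (\<open>\<one>\<index>\<close>)
  TensorO :: "'o \<Rightarrow> 'o \<Rightarrow> 'o"  (infixr \<open>\<otimes>\<index>\<close> 75)
  TensorM :: "'m \<Rightarrow> 'm \<Rightarrow> 'm"  (infixr \<open>\<boxtimes>\<index>\<close> 75)
  RDual :: "'o \<Rightarrow> 'o"  (\<open>rd\<index>\<close>)
  Ev :: "'o \<Rightarrow> 'm"  (\<open>ev\<index>\<close>)
  Coev :: "'o \<Rightarrow> 'm"  (\<open>coev\<index>\<close>)
  LDual :: "'o \<Rightarrow> 'o"  (\<open>ld\<index>\<close>)
  EvL :: "'o \<Rightarrow> 'm"  (\<open>ev''\<index>\<close>)
  CoevL :: "'o \<Rightarrow> 'm"  (\<open>coev''\<index>\<close>)


section \<open>Semisimple linear abelian categories\<close>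

locale linear_category =
  fixes C :: "('o, 'm::ab_group_add) tensor_data" (structure)
  assumes id_hom: "x \<in> Ob C \<Longrightarrow> id x \<in> Hom C x x"
    and comp_hom: "\<lbrakk>x \<in> Ob C; y \<in> Ob C; z \<in> Ob C; f \<in> Hom C x y; g \<in> Hom C y z\<rbrakk>
      \<Longrightarrow> g \<cdot> f \<in> Hom C x z"
    and comp_assoc: "\<lbrakk>w \<in> Ob C; x \<in> Ob C; y \<in> Ob C; z \<in> Ob C;
        f \<in> Hom C w x; g \<in> Hom C x y; h \<in> Hom C y z\<rbrakk>
      \<Longrightarrow> (h \<cdot> g) \<cdot> f = h \<cdot> (g \<cdot> f)"
    and id_left: "\<lbrakk>x \<in> Ob C; y \<in> Ob C; f \<in> Hom C x y\<rbrakk> \<Longrightarrow> id y \<cdot> f = f"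
    and id_right: "\<lbrakk>x \<in> Ob C; y \<in> Ob C; f \<in> Hom C x y\<rbrakk> \<Longrightarrow> f \<cdot> id x = f"
    and scale_vector_space: "vector_space (Scale C)"
    and hom_subspace: "\<lbrakk>x \<in> Ob C; y \<in> Ob C\<rbrakk> \<Longrightarrow> module.subspace (Scale C) (Hom C x y)"
    and comp_add_left: "\<lbrakk>x \<in> Ob C; y \<in> Ob C; z \<in> Ob C;
        f \<in> Hom C x y; g \<in> Hom C y z; g' \<in> Hom C y z\<rbrakk>
      \<Longrightarrow> (g + g') \<cdot> f = g \<cdot> f + g' \<cdot> f"
    and comp_add_right: "\<lbrakk>x \<in> Ob C; y \<in> Ob C; z \<in> Ob C;
        f \<in> Hom C x y; f' \<in> Hom C x y; g \<in> Hom C y z\<rbrakk>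
      \<Longrightarrow> g \<cdot> (f + f') = g \<cdot> f + g \<cdot> f'"
    and comp_scale_left: "\<lbrakk>x \<in> Ob C; y \<in> Ob C; z \<in> Ob C; f \<in> Hom C x y; g \<in> Hom C y z\<rbrakk>
      \<Longrightarrow> Scale C r g \<cdot> f = Scale C r (g \<cdot> f)"
    and comp_scale_right: "\<lbrakk>x \<in> Ob C; y \<in> Ob C; z \<in> Ob C; f \<in> Hom C x y; g \<in> Hom C y z\<rbrakk>
      \<Longrightarrow> g \<cdot> Scale C r f = Scale C r (g \<cdot> f)"

definition inverse_mor :: "('o, 'm) tensor_data \<Rightarrow> 'o \<Rightarrow> 'o \<Rightarrow> 'm \<Rightarrow> 'm \<Rightarrow> bool" where
  "inverse_mor C x y f g \<longleftrightarrow> f \<in> Hom C x y \<and> g \<in> Hom C y x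
     \<and> g \<cdot>\<^bsub>C\<^esub> f = id\<^bsub>C\<^esub> x \<and> f \<cdot>\<^bsub>C\<^esub> g = id\<^bsub>C\<^esub> y"

definition iso_mor :: "('o, 'm) tensor_data \<Rightarrow> 'o \<Rightarrow> 'o \<Rightarrow> 'm \<Rightarrow> bool" where
  "iso_mor C x y f \<longleftrightarrow> (\<exists>g. inverse_mor C x y f g)"

definition inv_mor :: "('o, 'm) tensor_data \<Rightarrow> 'o \<Rightarrow> 'o \<Rightarrow> 'm \<Rightarrow> 'm" where
  "inv_mor C x y f = (THE g. inverse_mor C x y f g)"

definition mono_mor :: "('o, 'm) tensor_data \<Rightarrow> 'o \<Rightarrow> 'o \<Rightarrow> 'm \<Rightarrow> bool" where
  "mono_mor C x y f \<longleftrightarrow> f \<in> Hom C x y \<and>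
     (\<forall>w\<in>Ob C. \<forall>g\<in>Hom C w x. \<forall>h\<in>Hom C w x. f \<cdot>\<^bsub>C\<^esub> g = f \<cdot>\<^bsub>C\<^esub> h \<longrightarrow> g = h)"

definition epi_mor :: "('o, 'm) tensor_data \<Rightarrow> 'o \<Rightarrow> 'o \<Rightarrow> 'm \<Rightarrow> bool" where
  "epi_mor C x y f \<longleftrightarrow> f \<in> Hom C x y \<and>
     (\<forall>z\<in>Ob C. \<forall>g\<in>Hom C y z. \<forall>h\<in>Hom C y z. g \<cdot>\<^bsub>C\<^esub> f = h \<cdot>\<^bsub>C\<^esub> f \<longrightarrow> g = h)"

definition zero_object :: "('o, 'm::ab_group_add) tensor_data \<Rightarrow> 'o \<Rightarrow> bool" where
  "zero_object C z \<longleftrightarrow> z \<in> Ob C \<and> (\<forall>x\<in>Ob C. Hom C x z = {0} \<and> Hom C z x = {0})"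

text \<open>\<open>kernel_mor C w x y k f\<close>: the morphism \<open>k : w \<rightarrow> x\<close> is a kernel of \<open>f : x \<rightarrow> y\<close>.\<close>

definition kernel_mor ::
    "('o, 'm::ab_group_add) tensor_data \<Rightarrow> 'o \<Rightarrow> 'o \<Rightarrow> 'o \<Rightarrow> 'm \<Rightarrow> 'm \<Rightarrow> bool" where
  "kernel_mor C w x y k f \<longleftrightarrow> k \<in> Hom C w x \<and> f \<in> Hom C x y \<and> f \<cdot>\<^bsub>C\<^esub> k = 0 \<and>
     (\<forall>v\<in>Ob C. \<forall>h\<in>Hom C v x. f \<cdot>\<^bsub>C\<^esub> h = 0 \<longrightarrow> (\<exists>!u. u \<in> Hom C v w \<and> k \<cdot>\<^bsub>C\<^esub> u = h))"

text \<open>\<open>cokernel_mor C x y z q f\<close>: the morphism \<open>q : y \<rightarrow> z\<close> is a cokernel of \<open>f : x \<rightarrow> y\<close>.\<close>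

definition cokernel_mor ::
    "('o, 'm::ab_group_add) tensor_data \<Rightarrow> 'o \<Rightarrow> 'o \<Rightarrow> 'o \<Rightarrow> 'm \<Rightarrow> 'm \<Rightarrow> bool" where
  "cokernel_mor C x y z q f \<longleftrightarrow> q \<in> Hom C y z \<and> f \<in> Hom C x y \<and> q \<cdot>\<^bsub>C\<^esub> f = 0 \<and>
     (\<forall>v\<in>Ob C. \<forall>h\<in>Hom C y v. h \<cdot>\<^bsub>C\<^esub> f = 0 \<longrightarrow> (\<exists>!u. u \<in> Hom C z v \<and> u \<cdot>\<^bsub>C\<^esub> q = h))"

definition direct_sum :: "('o, 'm::ab_group_add) tensor_data \<Rightarrow> nat \<Rightarrow> (nat \<Rightarrow> 'o)
    \<Rightarrow> (nat \<Rightarrow> 'm) \<Rightarrow> (nat \<Rightarrow> 'm) \<Rightarrow> 'o \<Rightarrow> bool" where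
  "direct_sum C n s \<iota> \<pi> x \<longleftrightarrow> x \<in> Ob C
     \<and> (\<forall>k<n. s k \<in> Ob C \<and> \<iota> k \<in> Hom C (s k) x \<and> \<pi> k \<in> Hom C x (s k))
     \<and> (\<forall>k<n. \<forall>l<n. \<pi> k \<cdot>\<^bsub>C\<^esub> \<iota> l = (if k = l then id\<^bsub>C\<^esub> (s k) else 0))
     \<and> (\<Sum>k<n. \<iota> k \<cdot>\<^bsub>C\<^esub> \<pi> k) = id\<^bsub>C\<^esub> x"

locale linear_abelian_category = linear_category +
  assumes zero_object_exists: "\<exists>z. zero_object C z"
    and biproduct_exists: "\<lbrakk>x \<in> Ob C; y \<in> Ob C\<rbrakk>
      \<Longrightarrow> \<exists>b \<iota> \<pi>. direct_sum C 2 (\<lambda>k. if k = 0 then x else y) \<iota> \<pi> b"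
    and kernel_exists: "\<lbrakk>x \<in> Ob C; y \<in> Ob C; f \<in> Hom C x y\<rbrakk>
      \<Longrightarrow> \<exists>w\<in>Ob C. \<exists>k. kernel_mor C w x y k f"
    and cokernel_exists: "\<lbrakk>x \<in> Ob C; y \<in> Ob C; f \<in> Hom C x y\<rbrakk>
      \<Longrightarrow> \<exists>z\<in>Ob C. \<exists>q. cokernel_mor C x y z q f"
    and mono_is_kernel: "\<lbrakk>x \<in> Ob C; y \<in> Ob C; mono_mor C x y f\<rbrakk>
      \<Longrightarrow> \<exists>z\<in>Ob C. \<exists>g. kernel_mor C x y z f g"
    and epi_is_cokernel: "\<lbrakk>x \<in> Ob C; y \<in> Ob C; epi_mor C x y f\<rbrakk>
      \<Longrightarrow> \<exists>w\<in>Ob C. \<exists>g. cokernel_mor C w x y f g"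

definition simple_object :: "('o, 'm::ab_group_add) tensor_data \<Rightarrow> 'o \<Rightarrow> bool" where
  "simple_object C x \<longleftrightarrow> x \<in> Ob C \<and> \<not> zero_object C x \<and>
     (\<forall>w\<in>Ob C. \<forall>i. mono_mor C w x i \<longrightarrow> zero_object C w \<or> iso_mor C w x i)"

definition semisimple :: "('o, 'm::ab_group_add) tensor_data \<Rightarrow> bool" where
  "semisimple C \<longleftrightarrow>
     (\<forall>x\<in>Ob C. \<exists>n s \<iota> \<pi>. direct_sum C n s \<iota> \<pi> x \<and> (\<forall>k<n. simple_object C (s k)))"


section \<open>Strict rigid monoidal categories\<close>

locale strict_monoidal_category = linear_category +
  assumes unit_ob: "\<one> \<in> Ob C"
    and tensor_ob: "\<lbrakk>x \<in> Ob C; y \<in> Ob C\<rbrakk> \<Longrightarrow> x \<otimes> y \<in> Ob C"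
    and tensor_hom: "\<lbrakk>x \<in> Ob C; y \<in> Ob C; z \<in> Ob C; w \<in> Ob C; f \<in> Hom C x y; g \<in> Hom C z w\<rbrakk>
      \<Longrightarrow> f \<boxtimes> g \<in> Hom C (x \<otimes> z) (y \<otimes> w)"
    and tensor_id: "\<lbrakk>x \<in> Ob C; y \<in> Ob C\<rbrakk> \<Longrightarrow> id x \<boxtimes> id y = id (x \<otimes> y)"
    and interchange: "\<lbrakk>x \<in> Ob C; y \<in> Ob C; z \<in> Ob C; x' \<in> Ob C; y' \<in> Ob C; z' \<in> Ob C;
        f \<in> Hom C x y; g \<in> Hom C y z; f' \<in> Hom C x' y'; g' \<in> Hom C y' z'\<rbrakk>
      \<Longrightarrow> (g \<cdot> f) \<boxtimes> (g' \<cdot> f') = (g \<boxtimes> g') \<cdot> (f \<boxtimes> f')"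
    and tensor_assoc_ob: "\<lbrakk>x \<in> Ob C; y \<in> Ob C; z \<in> Ob C\<rbrakk> \<Longrightarrow> (x \<otimes> y) \<otimes> z = x \<otimes> (y \<otimes> z)"
    and tensor_unit_ob: "x \<in> Ob C \<Longrightarrow> \<one> \<otimes> x = x" "x \<in> Ob C \<Longrightarrow> x \<otimes> \<one> = x"
    and tensor_assoc: "\<lbrakk>x \<in> Ob C; y \<in> Ob C; z \<in> Ob C; x' \<in> Ob C; y' \<in> Ob C; z' \<in> Ob C;
        f \<in> Hom C x x'; g \<in> Hom C y y'; h \<in> Hom C z z'\<rbrakk>
      \<Longrightarrow> (f \<boxtimes> g) \<boxtimes> h = f \<boxtimes> (g \<boxtimes> h)"
    and tensor_unit: "\<lbrakk>x \<in> Ob C; y \<in> Ob C; f \<in> Hom C x y\<rbrakk> \<Longrightarrow> id \<one> \<boxtimes> f = f"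
      "\<lbrakk>x \<in> Ob C; y \<in> Ob C; f \<in> Hom C x y\<rbrakk> \<Longrightarrow> f \<boxtimes> id \<one> = f"
    and tensor_add_left: "\<lbrakk>x \<in> Ob C; y \<in> Ob C; z \<in> Ob C; w \<in> Ob C;
        f \<in> Hom C x y; f' \<in> Hom C x y; g \<in> Hom C z w\<rbrakk>
      \<Longrightarrow> (f + f') \<boxtimes> g = f \<boxtimes> g + f' \<boxtimes> g"
    and tensor_add_right: "\<lbrakk>x \<in> Ob C; y \<in> Ob C; z \<in> Ob C; w \<in> Ob C;
        f \<in> Hom C x y; g \<in> Hom C z w; g' \<in> Hom C z w\<rbrakk>
      \<Longrightarrow> f \<boxtimes> (g + g') = f \<boxtimes> g + f \<boxtimes> g'"
    and tensor_scale_left: "\<lbrakk>x \<in> Ob C; y \<in> Ob C; z \<in> Ob C; w \<in> Ob C;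
        f \<in> Hom C x y; g \<in> Hom C z w\<rbrakk>
      \<Longrightarrow> Scale C r f \<boxtimes> g = Scale C r (f \<boxtimes> g)"
    and tensor_scale_right: "\<lbrakk>x \<in> Ob C; y \<in> Ob C; z \<in> Ob C; w \<in> Ob C;
        f \<in> Hom C x y; g \<in> Hom C z w\<rbrakk>
      \<Longrightarrow> f \<boxtimes> Scale C r g = Scale C r (f \<boxtimes> g)"

text \<open>
  The last four assumptions express that the canonical isomorphisms identifying the right dual of
  the left dual of \<open>c\<close>, and the left dual of the right dual of \<open>c\<close>, with \<open>c\<close> are identities.
\<close>

locale strict_rigid_category = strict_monoidal_category +
  assumes rdual_ob: "c \<in> Ob C \<Longrightarrow> rd c \<in> Ob C"
    and ev_hom: "c \<in> Ob C \<Longrightarrow> ev c \<in> Hom C (rd c \<otimes> c) \<one>"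
    and coev_hom: "c \<in> Ob C \<Longrightarrow> coev c \<in> Hom C \<one> (c \<otimes> rd c)"
    and rdual_zigzag: "c \<in> Ob C \<Longrightarrow> (id c \<boxtimes> ev c) \<cdot> (coev c \<boxtimes> id c) = id c"
      "c \<in> Ob C \<Longrightarrow> (ev c \<boxtimes> id (rd c)) \<cdot> (id (rd c) \<boxtimes> coev c) = id (rd c)"
    and ldual_ob: "c \<in> Ob C \<Longrightarrow> ld c \<in> Ob C"
    and ev'_hom: "c \<in> Ob C \<Longrightarrow> ev' c \<in> Hom C (c \<otimes> ld c) \<one>"
    and coev'_hom: "c \<in> Ob C \<Longrightarrow> coev' c \<in> Hom C \<one> (ld c \<otimes> c)"
    and ldual_zigzag: "c \<in> Ob C \<Longrightarrow> (ev' c \<boxtimes> id c) \<cdot> (id c \<boxtimes> coev' c) = id c"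
      "c \<in> Ob C \<Longrightarrow> (id (ld c) \<boxtimes> ev' c) \<cdot> (coev' c \<boxtimes> id (ld c)) = id (ld c)"
    and rdual_ldual: "c \<in> Ob C \<Longrightarrow> rd (ld c) = c"
    and ldual_rdual: "c \<in> Ob C \<Longrightarrow> ld (rd c) = c"
    and ev_ldual: "c \<in> Ob C \<Longrightarrow> ev (ld c) = ev' c"
    and coev_ldual: "c \<in> Ob C \<Longrightarrow> coev (ld c) = coev' c"

locale fusion_category = linear_abelian_category + strict_rigid_category +
  assumes semisimple: "semisimple C"
    and hom_finite_dim: "\<lbrakk>x \<in> Ob C; y \<in> Ob C\<rbrakk>
      \<Longrightarrow> \<exists>B. finite B \<and> Hom C x y = module.span (Scale C) B"
    and unit_simple: "simple_object C \<one>"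
    and finitely_many_simples: "\<exists>S. finite S \<and> S \<subseteq> Ob C \<and>
      (\<forall>x. simple_object C x \<longrightarrow> (\<exists>s\<in>S. \<exists>f. iso_mor C x s f))"


section \<open>Pivotal structures\<close>

text \<open>The right dual \<open>rd d \<rightarrow> rd c\<close> of a morphism \<open>f : c \<rightarrow> d\<close>.\<close>

definition dual_mor :: "('o, 'm) tensor_data \<Rightarrow> 'o \<Rightarrow> 'o \<Rightarrow> 'm \<Rightarrow> 'm" where
  "dual_mor C c d f = (ev\<^bsub>C\<^esub> d \<boxtimes>\<^bsub>C\<^esub> id\<^bsub>C\<^esub> (rd\<^bsub>C\<^esub> c))
     \<cdot>\<^bsub>C\<^esub> (id\<^bsub>C\<^esub> (rd\<^bsub>C\<^esub> d) \<boxtimes>\<^bsub>C\<^esub> f \<boxtimes>\<^bsub>C\<^esub> id\<^bsub>C\<^esub> (rd\<^bsub>C\<^esub> c))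
     \<cdot>\<^bsub>C\<^esub> (id\<^bsub>C\<^esub> (rd\<^bsub>C\<^esub> d) \<boxtimes>\<^bsub>C\<^esub> coev\<^bsub>C\<^esub> c)"

definition double_dual_mor :: "('o, 'm) tensor_data \<Rightarrow> 'o \<Rightarrow> 'o \<Rightarrow> 'm \<Rightarrow> 'm" where
  "double_dual_mor C c d f = dual_mor C (rd\<^bsub>C\<^esub> d) (rd\<^bsub>C\<^esub> c) (dual_mor C c d f)"

text \<open>
  Two right duals of one object, one with object \<open>p\<close> and evaluation \<open>e\<close>, the other with object \<open>q\<close>
  and coevaluation \<open>k\<close>, are related by a canonical isomorphism \<open>p \<rightarrow> q\<close>.
\<close>

definition dual_comparison :: "('o, 'm) tensor_data \<Rightarrow> 'o \<Rightarrow> 'm \<Rightarrow> 'o \<Rightarrow> 'm \<Rightarrow> 'm" where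
  "dual_comparison C p e q k = (e \<boxtimes>\<^bsub>C\<^esub> id\<^bsub>C\<^esub> q) \<cdot>\<^bsub>C\<^esub> (id\<^bsub>C\<^esub> p \<boxtimes>\<^bsub>C\<^esub> k)"

text \<open>
  The object \<open>rd d \<otimes> rd c\<close> is a right dual of \<open>c \<otimes> d\<close>; the next two morphisms are the mutually
  inverse comparisons \<open>rd d \<otimes> rd c \<rightarrow> rd (c \<otimes> d)\<close> and \<open>rd (c \<otimes> d) \<rightarrow> rd d \<otimes> rd c\<close>.
\<close>

definition dual_tensor :: "('o, 'm) tensor_data \<Rightarrow> 'o \<Rightarrow> 'o \<Rightarrow> 'm" where
  "dual_tensor C c d = dual_comparison C
     (rd\<^bsub>C\<^esub> d \<otimes>\<^bsub>C\<^esub> rd\<^bsub>C\<^esub> c) (ev\<^bsub>C\<^esub> d \<cdot>\<^bsub>C\<^esub> (id\<^bsub>C\<^esub> (rd\<^bsub>C\<^esub> d) \<boxtimes>\<^bsub>C\<^esub> ev\<^bsub>C\<^esub> c \<boxtimes>\<^bsub>C\<^esub> id\<^bsub>C\<^esub> d))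
     (rd\<^bsub>C\<^esub> (c \<otimes>\<^bsub>C\<^esub> d)) (coev\<^bsub>C\<^esub> (c \<otimes>\<^bsub>C\<^esub> d))"

definition dual_tensor_inv :: "('o, 'm) tensor_data \<Rightarrow> 'o \<Rightarrow> 'o \<Rightarrow> 'm" where
  "dual_tensor_inv C c d = dual_comparison C
     (rd\<^bsub>C\<^esub> (c \<otimes>\<^bsub>C\<^esub> d)) (ev\<^bsub>C\<^esub> (c \<otimes>\<^bsub>C\<^esub> d))
     (rd\<^bsub>C\<^esub> d \<otimes>\<^bsub>C\<^esub> rd\<^bsub>C\<^esub> c)
     ((id\<^bsub>C\<^esub> c \<boxtimes>\<^bsub>C\<^esub> coev\<^bsub>C\<^esub> d \<boxtimes>\<^bsub>C\<^esub> id\<^bsub>C\<^esub> (rd\<^bsub>C\<^esub> c)) \<cdot>\<^bsub>C\<^esub> coev\<^bsub>C\<^esub> c)"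

text \<open>
  The monoidal structure of the double dual functor, with components
  \<open>rd (rd c) \<otimes> rd (rd d) \<rightarrow> rd (rd d \<otimes> rd c) \<rightarrow> rd (rd (c \<otimes> d))\<close> and
  \<open>\<one> \<rightarrow> rd \<one> \<rightarrow> rd (rd \<one>)\<close>; by strictness \<open>coev \<one> : \<one> \<rightarrow> rd \<one>\<close> and \<open>ev \<one> : rd \<one> \<rightarrow> \<one>\<close>.
\<close>

definition double_dual_tensor :: "('o, 'm) tensor_data \<Rightarrow> 'o \<Rightarrow> 'o \<Rightarrow> 'm" where
  "double_dual_tensor C c d =
     dual_mor C (rd\<^bsub>C\<^esub> (c \<otimes>\<^bsub>C\<^esub> d)) (rd\<^bsub>C\<^esub> d \<otimes>\<^bsub>C\<^esub> rd\<^bsub>C\<^esub> c) (dual_tensor_inv C c d)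
     \<cdot>\<^bsub>C\<^esub> dual_tensor C (rd\<^bsub>C\<^esub> d) (rd\<^bsub>C\<^esub> c)"

definition double_dual_unit :: "('o, 'm) tensor_data \<Rightarrow> 'm" where
  "double_dual_unit C = dual_mor C (rd\<^bsub>C\<^esub> \<one>\<^bsub>C\<^esub>) \<one>\<^bsub>C\<^esub> (ev\<^bsub>C\<^esub> \<one>\<^bsub>C\<^esub>) \<cdot>\<^bsub>C\<^esub> coev\<^bsub>C\<^esub> \<one>\<^bsub>C\<^esub>"

text \<open>
  A pivotal structure is an extensional family indexed by the objects, so that equality of pivotal
  structures is equality of functions.
\<close>

definition pivotal_structure :: "('o, 'm) tensor_data \<Rightarrow> ('o \<Rightarrow> 'm) \<Rightarrow> bool" where
  "pivotal_structure C a \<longleftrightarrow>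
     a \<in> (\<Pi>\<^sub>E x\<in>Ob C. Hom C x (rd\<^bsub>C\<^esub> (rd\<^bsub>C\<^esub> x)))
     \<and> (\<forall>x\<in>Ob C. iso_mor C x (rd\<^bsub>C\<^esub> (rd\<^bsub>C\<^esub> x)) (a x))
     \<and> (\<forall>x\<in>Ob C. \<forall>y\<in>Ob C. \<forall>f\<in>Hom C x y. a y \<cdot>\<^bsub>C\<^esub> f = double_dual_mor C x y f \<cdot>\<^bsub>C\<^esub> a x)
     \<and> (\<forall>x\<in>Ob C. \<forall>y\<in>Ob C. a (x \<otimes>\<^bsub>C\<^esub> y) = double_dual_tensor C x y \<cdot>\<^bsub>C\<^esub> (a x \<boxtimes>\<^bsub>C\<^esub> a y))
     \<and> a \<one>\<^bsub>C\<^esub> = double_dual_unit C"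

text \<open>
  Traces are elements of \<open>Hom C \<one> \<one>\<close>, which for a fusion category is spanned by \<open>id \<one>\<close> and is
  thereby identified with the complex numbers. In the left trace, \<open>rd (rd (ld c)) = rd c\<close>.
\<close>

definition left_trace :: "('o, 'm) tensor_data \<Rightarrow> ('o \<Rightarrow> 'm) \<Rightarrow> 'o \<Rightarrow> 'm \<Rightarrow> 'm" where
  "left_trace C a c f = ev\<^bsub>C\<^esub> c \<cdot>\<^bsub>C\<^esub> (a (ld\<^bsub>C\<^esub> c) \<boxtimes>\<^bsub>C\<^esub> f) \<cdot>\<^bsub>C\<^esub> coev'\<^bsub>C\<^esub> c"

definition right_trace :: "('o, 'm) tensor_data \<Rightarrow> ('o \<Rightarrow> 'm) \<Rightarrow> 'o \<Rightarrow> 'm \<Rightarrow> 'm" where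
  "right_trace C a c f =
     ev\<^bsub>C\<^esub> (rd\<^bsub>C\<^esub> c) \<cdot>\<^bsub>C\<^esub> ((a c \<cdot>\<^bsub>C\<^esub> f) \<boxtimes>\<^bsub>C\<^esub> id\<^bsub>C\<^esub> (rd\<^bsub>C\<^esub> c)) \<cdot>\<^bsub>C\<^esub> coev\<^bsub>C\<^esub> c"

definition dimension :: "('o, 'm) tensor_data \<Rightarrow> ('o \<Rightarrow> 'm) \<Rightarrow> 'o \<Rightarrow> 'm" where
  "dimension C a c = left_trace C a c (id\<^bsub>C\<^esub> c)"

definition spherical :: "('o, 'm) tensor_data \<Rightarrow> ('o \<Rightarrow> 'm) \<Rightarrow> bool" where
  "spherical C a \<longleftrightarrow> (\<forall>c\<in>Ob C. \<forall>f\<in>Hom C c c. left_trace C a c f = right_trace C a c f)"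


section \<open>The conjugate pivotal structure\<close>

text \<open>
  The condition on a morphism \<open>t : x \<rightarrow> ld (ld x)\<close> that is to define the inverse of the component
  of the conjugate of \<open>a\<close> at \<open>ld (ld x)\<close>.
\<close>

definition conjugate_condition ::
    "('o, 'm) tensor_data \<Rightarrow> ('o \<Rightarrow> 'm) \<Rightarrow> 'o \<Rightarrow> 'm \<Rightarrow> bool" where
  "conjugate_condition C a x t \<longleftrightarrow>
     (\<forall>c\<in>Ob C. \<forall>d\<in>Ob C.
       \<forall>f\<in>Hom C c (d \<otimes>\<^bsub>C\<^esub> x). \<forall>g\<in>Hom C (d \<otimes>\<^bsub>C\<^esub> ld\<^bsub>C\<^esub> (ld\<^bsub>C\<^esub> x)) c.
         left_trace C a c (g \<cdot>\<^bsub>C\<^esub> (id\<^bsub>C\<^esub> d \<boxtimes>\<^bsub>C\<^esub> t) \<cdot>\<^bsub>C\<^esub> f) =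
         left_trace C a d ((id\<^bsub>C\<^esub> d \<boxtimes>\<^bsub>C\<^esub> ev'\<^bsub>C\<^esub> x)
           \<cdot>\<^bsub>C\<^esub> ((f \<cdot>\<^bsub>C\<^esub> g) \<boxtimes>\<^bsub>C\<^esub> id\<^bsub>C\<^esub> (ld\<^bsub>C\<^esub> x))
           \<cdot>\<^bsub>C\<^esub> (id\<^bsub>C\<^esub> d \<boxtimes>\<^bsub>C\<^esub> coev'\<^bsub>C\<^esub> (ld\<^bsub>C\<^esub> x))))"

text \<open>The component of \<open>b\<close> at \<open>ld (ld x)\<close> is a morphism \<open>ld (ld x) \<rightarrow> rd (rd (ld (ld x))) = x\<close>.\<close>

definition is_conjugate :: "('o, 'm) tensor_data \<Rightarrow> ('o \<Rightarrow> 'm) \<Rightarrow> ('o \<Rightarrow> 'm) \<Rightarrow> bool" where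
  "is_conjugate C a b \<longleftrightarrow> pivotal_structure C b \<and>
     (\<forall>x\<in>Ob C. conjugate_condition C a x
        (inv_mor C (ld\<^bsub>C\<^esub> (ld\<^bsub>C\<^esub> x)) x (b (ld\<^bsub>C\<^esub> (ld\<^bsub>C\<^esub> x)))))"

definition conjugate :: "('o, 'm) tensor_data \<Rightarrow> ('o \<Rightarrow> 'm) \<Rightarrow> 'o \<Rightarrow> 'm" where
  "conjugate C a = (THE b. is_conjugate C a b)"

end

theory Submission
  imports Defs "HOL-Computational_Algebra.Fundamental_Theorem_Algebra"
begin

text \<open>
  Cyclicity and multiplicativity of the left trace turn the defining condition of the conjugate
  \<open>b\<close> of \<open>a\<close> into the statement that the right trace of \<open>b\<close> is the left trace of \<open>a\<close>. As the left
  trace at \<open>x\<close> is the right trace of the transpose at \<open>ld x\<close>, the left trace of \<open>b\<close> is then the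
  right trace of \<open>a\<close>, which yields (ii), (iii) and (iv). For existence, both trace pairings are
  nondegenerate: a nonzero morphism splits off a simple object, and a nonzero coevaluation splits
  because the unit is simple. By Schur's lemma there are thus automorphisms \<open>lam c\<close> with
  \<open>left_trace a c v = right_trace a c (v \<cdot> lam c)\<close>; nondegeneracy makes \<open>lam\<close> a monoidal natural
  automorphism of the identity functor, and the conjugate is \<open>a \<cdot> lam\<close>.
\<close>

section \<open>Typed morphisms\<close>

text \<open>The defining condition ranges over all \<open>c\<close>, \<open>d\<close>,
  \<open>f\<close>, \<open>g\<close>, yet closing off the strand \<open>d\<close> reduces it to
  trivial \<open>d\<close>; this rests on multiplicativity of the left trace, the diagrammatic bulk
  of the proof. The difficulty there is that a pivotal structure is monoidal only up to the
  structure maps of the double dual, which must be cancelled against caps and cups. For the left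
  trace, moreover, the pivotal morphism sits at \<open>ld (x \<otimes> y)\<close>, to which the
  tensor formula does not apply directly.

  An automorphism glued from scalars on simple summands would have to be shown independent of the
  decomposition and natural. Characterising \<open>lam\<close> by the two traces avoids both: a
  decomposition serves only to prove existence. On a simple object \<open>lam\<close> is the ratio
  of left to right dimension, so both dimensions must be nonzero. Its multiplicativity comes from a
  mixed closure, one strand on the left and the other on the right, which can be evaluated in either
  order.\<close>

text \<open>A typed morphism. With the objects attached, the side conditions of the category laws become
  equations between objects that the simplifier decides.\<close>

datatype ('o, 'm) arrow = Arrow (src: 'o) (mor: 'm) (trg: 'o)

context strict_monoidal_category
begin

definition arr :: "('a, 'b) arrow \<Rightarrow> bool" where
  "arr f \<longleftrightarrow> src f \<in> Ob C \<and> trg f \<in> Ob C \<and> mor f \<in> Hom C (src f) (trg f)"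

definition I :: "'a \<Rightarrow> ('a, 'b) arrow" where
  "I x = Arrow x (id x) x"

definition acomp :: "('a, 'b) arrow \<Rightarrow> ('a, 'b) arrow \<Rightarrow> ('a, 'b) arrow"  (infixr \<open>\<bullet>\<close> 70) where
  "g \<bullet> f = Arrow (src f) (mor g \<cdot> mor f) (trg g)"

definition atensor :: "('a, 'b) arrow \<Rightarrow> ('a, 'b) arrow \<Rightarrow> ('a, 'b) arrow"  (infixr \<open>\<odot>\<close> 75) where
  "f \<odot> g = Arrow (src f \<otimes> src g) (mor f \<boxtimes> mor g) (trg f \<otimes> trg g)"

lemma arrow_sel [simp]:
  "src (I x) = x" "trg (I x) = x" "mor (I x) = id x"
  "src (g \<bullet> f) = src f" "trg (g \<bullet> f) = trg g" "mor (g \<bullet> f) = mor g \<cdot> mor f"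
  "src (f \<odot> g) = src f \<otimes> src g" "trg (f \<odot> g) = trg f \<otimes> trg g" "mor (f \<odot> g) = mor f \<boxtimes> mor g"
  by (simp_all add: I_def acomp_def atensor_def)

lemma arr_ob [simp]: "arr f \<Longrightarrow> src f \<in> Ob C" "arr f \<Longrightarrow> trg f \<in> Ob C"
  by (simp_all add: arr_def)

lemma arr_Arrow [simp]: "\<lbrakk>f \<in> Hom C x y; x \<in> Ob C; y \<in> Ob C\<rbrakk> \<Longrightarrow> arr (Arrow x f y)"
  by (simp add: arr_def)

lemma tensor_ob_simps [simp]:
  "\<one> \<in> Ob C" "\<lbrakk>x \<in> Ob C; y \<in> Ob C\<rbrakk> \<Longrightarrow> x \<otimes> y \<in> Ob C"
  "\<lbrakk>x \<in> Ob C; y \<in> Ob C; z \<in> Ob C\<rbrakk> \<Longrightarrow> (x \<otimes> y) \<otimes> z = x \<otimes> y \<otimes> z"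
  "x \<in> Ob C \<Longrightarrow> \<one> \<otimes> x = x" "x \<in> Ob C \<Longrightarrow> x \<otimes> \<one> = x"
  by (simp_all add: unit_ob tensor_ob tensor_assoc_ob tensor_unit_ob)

lemma arr_I [simp]: "x \<in> Ob C \<Longrightarrow> arr (I x)"
  by (simp add: arr_def id_hom)

lemma arr_comp [simp]: "\<lbrakk>arr g; arr f; trg f = src g\<rbrakk> \<Longrightarrow> arr (g \<bullet> f)"
  unfolding arr_def using comp_hom[of "src f" "src g" "trg g" "mor f" "mor g"] by simp

lemma arr_tensor [simp]: "\<lbrakk>arr f; arr g\<rbrakk> \<Longrightarrow> arr (f \<odot> g)"
  unfolding arr_def using tensor_hom[of "src f" "trg f" "src g" "trg g" "mor f" "mor g"] by simp

lemma arr_in_hom: "\<lbrakk>arr f; src f = x; trg f = y\<rbrakk> \<Longrightarrow> mor f \<in> Hom C x y"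
  by (auto simp: arr_def)

lemma acomp_assoc [simp]:
  "\<lbrakk>arr h; arr g; arr f; trg f = src g; trg g = src h\<rbrakk> \<Longrightarrow> (h \<bullet> g) \<bullet> f = h \<bullet> g \<bullet> f"
  unfolding arr_def
  using comp_assoc[of "src f" "src g" "src h" "trg h" "mor f" "mor g" "mor h"]
  by (intro arrow.expand) simp

lemma comp_I_left [simp]: "\<lbrakk>arr f; trg f = x\<rbrakk> \<Longrightarrow> I x \<bullet> f = f"
  unfolding arr_def using id_left[of "src f" "trg f" "mor f"] by (auto intro: arrow.expand)

lemma comp_I_right [simp]: "\<lbrakk>arr f; src f = x\<rbrakk> \<Longrightarrow> f \<bullet> I x = f"
  unfolding arr_def using id_right[of "src f" "trg f" "mor f"] by (auto intro: arrow.expand)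

lemma atensor_assoc [simp]:
  "\<lbrakk>arr f; arr g; arr h\<rbrakk> \<Longrightarrow> (f \<odot> g) \<odot> h = f \<odot> g \<odot> h"
  unfolding arr_def
  using tensor_assoc[of "src f" "src g" "src h" "trg f" "trg g" "trg h" "mor f" "mor g" "mor h"]
  by (intro arrow.expand) simp

lemma tensor_I_unit [simp]: "arr f \<Longrightarrow> I \<one> \<odot> f = f" "arr f \<Longrightarrow> f \<odot> I \<one> = f"
  unfolding arr_def using tensor_unit[of "src f" "trg f" "mor f"]
  by (auto intro: arrow.expand)

lemma I_tensor_I [simp]: "\<lbrakk>x \<in> Ob C; y \<in> Ob C\<rbrakk> \<Longrightarrow> I x \<odot> I y = I (x \<otimes> y)"
  by (rule arrow.expand) (simp add: tensor_id)

text \<open>Tensor products are normalised to the right, so two adjacent identity strands followed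
  by a further factor no longer match \<open>I_tensor_I\<close>.\<close>

lemma I_tensor_I_tensor [simp]:
  "\<lbrakk>x \<in> Ob C; y \<in> Ob C; arr f\<rbrakk> \<Longrightarrow> I x \<odot> I y \<odot> f = I (x \<otimes> y) \<odot> f"
  by (metis I_tensor_I arr_I atensor_assoc)

lemma ainterchange:
  "\<lbrakk>arr f; arr g; arr f'; arr g'; trg f = src g; trg f' = src g'\<rbrakk>
    \<Longrightarrow> (g \<bullet> f) \<odot> (g' \<bullet> f') = (g \<odot> g') \<bullet> (f \<odot> f')"
  unfolding arr_def
  using interchange[of "src f" "src g" "trg g" "src f'" "src g'" "trg g'" "mor f" "mor g" "mor f'" "mor g'"]
  by (intro arrow.expand) simp

lemma whisker_left:
  assumes "arr g" "arr f" "trg f = src g" "x \<in> Ob C"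
  shows "I x \<odot> (g \<bullet> f) = (I x \<odot> g) \<bullet> (I x \<odot> f)"
  using ainterchange[of "I x" "I x" f g] assms by simp

lemma whisker_right:
  assumes "arr g" "arr f" "trg f = src g" "x \<in> Ob C"
  shows "(g \<bullet> f) \<odot> I x = (g \<odot> I x) \<bullet> (f \<odot> I x)"
  using ainterchange[of f g "I x" "I x"] assms by simp

lemmas whisker = whisker_left whisker_right

lemma tensor_left_last: "\<lbrakk>arr f; arr g; src f = x; trg g = y\<rbrakk> \<Longrightarrow> (f \<odot> I y) \<bullet> (I x \<odot> g) = f \<odot> g"
  using ainterchange[of "I x" f g "I y"] by auto

lemma tensor_right_last: "\<lbrakk>arr f; arr g; trg f = x; src g = y\<rbrakk> \<Longrightarrow> (I x \<odot> g) \<bullet> (f \<odot> I y) = f \<odot> g"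
  using ainterchange[of f "I x" "I y" g] by auto

lemma exchange:
  "\<lbrakk>arr f; arr g; src f = x; trg f = x'; src g = y; trg g = y'\<rbrakk>
    \<Longrightarrow> (f \<odot> I y') \<bullet> (I x \<odot> g) = (I x' \<odot> g) \<bullet> (f \<odot> I y)"
  by (simp add: tensor_left_last tensor_right_last)

text \<open>Composites are kept nested to the right by \<open>acomp_assoc\<close>, so an equation
  between two-factor composites does not match inside a longer one. Carrying the tail
  \<open>h\<close> turns it into a usable rewrite rule; \<open>comp_reduce1\<close> does the same
  when the right side is a single arrow.\<close>

lemma comp_reduce:
  "\<lbrakk>g \<bullet> f = g' \<bullet> f'; arr g; arr f; arr g'; arr f'; arr h; trg h = src f; trg f = src g;
    src f' = src f; trg f' = src g'\<rbrakk>
    \<Longrightarrow> g \<bullet> f \<bullet> h = g' \<bullet> f' \<bullet> h"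
  by (metis acomp_assoc)

lemma comp_reduce1:
  "\<lbrakk>g \<bullet> f = k; arr g; arr f; arr h; trg h = src f; trg f = src g\<rbrakk> \<Longrightarrow> g \<bullet> f \<bullet> h = k \<bullet> h"
  by (metis acomp_assoc)

section \<open>Bending strands and uniqueness of duals\<close>

definition comparison :: "'a \<Rightarrow> ('a, 'b) arrow \<Rightarrow> 'a \<Rightarrow> ('a, 'b) arrow \<Rightarrow> ('a, 'b) arrow" where
  "comparison p e q k = (e \<odot> I q) \<bullet> (I p \<odot> k)"

text \<open>The caps \<open>e\<close> and \<open>e'\<close> act on disjoint strands and can be
  exchanged; what remains is a snake, which is straight in a dual pair. Here \<open>e\<close> and
  \<open>k\<close> are arbitrary bends, which makes transposes instances of
  \<open>comparison\<close> too.\<close>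

lemma ev_comparison:
  assumes [simp]: "p \<in> Ob C" "q \<in> Ob C" "c \<in> Ob C" "d \<in> Ob C"
    and [simp]: "arr e" "src e = p \<otimes> c" "trg e = \<one>"
    and [simp]: "arr k" "src k = \<one>" "trg k = c \<otimes> q"
    and [simp]: "arr e'" "src e' = q \<otimes> d" "trg e' = \<one>"
  shows "e' \<bullet> (comparison p e q k \<odot> I d) = e \<bullet> (I p \<odot> ((I c \<odot> e') \<bullet> (k \<odot> I d)))"
proof -
  have "e' \<bullet> (e \<odot> I (q \<otimes> d)) = e \<bullet> (I (p \<otimes> c) \<odot> e')"
    using exchange[of e e' "p \<otimes> c" \<one> "q \<otimes> d" \<one>] by simp
  from comp_reduce[OF this] show ?thesis
    by (simp add: comparison_def whisker)
qed

lemma comparison_coev: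
  assumes [simp]: "p \<in> Ob C" "q \<in> Ob C" "c \<in> Ob C" "d \<in> Ob C"
    and [simp]: "arr e" "src e = p \<otimes> c" "trg e = \<one>"
    and [simp]: "arr k" "src k = \<one>" "trg k = c \<otimes> q"
    and [simp]: "arr k'" "src k' = \<one>" "trg k' = d \<otimes> p"
  shows "(I d \<odot> comparison p e q k) \<bullet> k' = (((I d \<odot> e) \<bullet> (k' \<odot> I c)) \<odot> I q) \<bullet> k"
proof -
  have "(I (d \<otimes> p) \<odot> k) \<bullet> k' = (k' \<odot> I (c \<otimes> q)) \<bullet> k"
    using exchange[of k' k \<one> "d \<otimes> p" \<one> "c \<otimes> q"] by simp
  then show ?thesis
    by (simp add: comparison_def whisker)
qed

definition dual_pair :: "'a \<Rightarrow> 'a \<Rightarrow> ('a, 'b) arrow \<Rightarrow> ('a, 'b) arrow \<Rightarrow> bool" where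
  "dual_pair c p e k \<longleftrightarrow> c \<in> Ob C \<and> p \<in> Ob C
     \<and> arr e \<and> src e = p \<otimes> c \<and> trg e = \<one> \<and> arr k \<and> src k = \<one> \<and> trg k = c \<otimes> p
     \<and> (I c \<odot> e) \<bullet> (k \<odot> I c) = I c \<and> (e \<odot> I p) \<bullet> (I p \<odot> k) = I p"

lemma ev_comparison_dual_pair:
  assumes "dual_pair c q e' k" "p \<in> Ob C" "arr e" "src e = p \<otimes> c" "trg e = \<one>"
  shows "e' \<bullet> (comparison p e q k \<odot> I c) = e"
  using assms ev_comparison[of p q c c e k e'] by (simp add: dual_pair_def)

lemma comparison_coev_dual_pair:
  assumes "dual_pair c p e k'" "q \<in> Ob C" "arr k" "src k = \<one>" "trg k = c \<otimes> q"
  shows "(I c \<odot> comparison p e q k) \<bullet> k' = k"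
  using assms comparison_coev[of p q c c e k k'] by (simp add: dual_pair_def)

lemma arr_comparison [simp]:
  assumes "p \<in> Ob C" "q \<in> Ob C" "arr e" "trg e = \<one>" "arr k" "src k = \<one>"
    "c \<in> Ob C" "src e = p \<otimes> c" "trg k = c \<otimes> q"
  shows "arr (comparison p e q k)"
  using assms by (simp add: comparison_def)

lemma comparison_sel [simp]:
  "\<lbrakk>p \<in> Ob C; src k = \<one>\<rbrakk> \<Longrightarrow> src (comparison p e q k) = p"
  "\<lbrakk>q \<in> Ob C; trg e = \<one>\<rbrakk> \<Longrightarrow> trg (comparison p e q k) = q"
  by (simp_all add: comparison_def)

text \<open>Bending \<open>f\<close> down by \<open>e\<close> and up again by \<open>k\<close> is a
  zigzag. A morphism into a dual is thus determined by its evaluation;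
  \<open>dual_pair_cancel\<close> turns this into the test by which such morphisms are proved
  equal.\<close>

lemma comparison_ev_comp:
  assumes dp: "dual_pair c p e k" and f: "arr f" "trg f = p"
  shows "comparison (src f) (e \<bullet> (f \<odot> I c)) p k = f"
proof -
  note [simp] = dp[unfolded dual_pair_def] f
  have "(f \<odot> I (c \<otimes> p)) \<bullet> (I (src f) \<odot> k) = (I p \<odot> k) \<bullet> f"
    using exchange[of f k "src f" p \<one> "c \<otimes> p"] by simp
  then have "comparison (src f) (e \<bullet> (f \<odot> I c)) p k = (e \<odot> I p) \<bullet> (I p \<odot> k) \<bullet> f"
    by (simp add: comparison_def whisker)
  also have "\<dots> = f"
    using comp_reduce[of "e \<odot> I p" "I p \<odot> k" "I p" "I p" f] by simp
  finally show ?thesis .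
qed

lemma dual_pair_cancel:
  assumes "dual_pair c p e k" "arr f" "trg f = p" "arr g" "trg g = p" "src f = src g"
    and "e \<bullet> (f \<odot> I c) = e \<bullet> (g \<odot> I c)"
  shows "f = g"
  using assms by (metis comparison_ev_comp)

lemma comparison_inverse:
  assumes "dual_pair c p e k" "dual_pair c q e' k'"
  shows "comparison q e' p k \<bullet> comparison p e q k' = I p"
proof (rule dual_pair_cancel[OF assms(1)])
  note [simp] = assms[unfolded dual_pair_def]
  have [simp]: "arr (comparison q e' p k)" "arr (comparison p e q k')"
    by (rule arr_comparison[where c = c]; simp)+
  note ev_comparison_dual_pair[OF assms(1), of q e', simp]
    ev_comparison_dual_pair[OF assms(2), of p e, simp]
  show "arr (comparison q e' p k \<bullet> comparison p e q k')" by simp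
  show "e \<bullet> ((comparison q e' p k \<bullet> comparison p e q k') \<odot> I c) = e \<bullet> (I p \<odot> I c)"
    using comp_reduce[of e "comparison q e' p k \<odot> I c" e' "I (q \<otimes> c)" "comparison p e q k' \<odot> I c"]
    by (simp add: whisker)
qed (use assms in \<open>simp_all add: dual_pair_def\<close>)

lemma dual_pair_tensor:
  assumes c: "dual_pair c p e k" and d: "dual_pair d q e' k'"
  shows "dual_pair (c \<otimes> d) (q \<otimes> p) (e' \<bullet> (I q \<odot> e \<odot> I d)) ((I c \<odot> k' \<odot> I p) \<bullet> k)"
proof -
  note [simp] = assms[unfolded dual_pair_def]
  \<comment> \<open>\<open>1\<close> and \<open>4\<close> exchange the inner cap \<open>e\<close>
    with the inner cup \<open>k'\<close>; this leaves the snakes of \<open>c\<close>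
    (\<open>2\<close> and \<open>5\<close>) and of \<open>d\<close> (\<open>3\<close> and
    \<open>6\<close>).\<close>
  have 1: "(I (c \<otimes> d \<otimes> q) \<odot> e \<odot> I d) \<bullet> (I c \<odot> k' \<odot> I (p \<otimes> c \<otimes> d))
      = (I c \<odot> k' \<odot> I d) \<bullet> (I c \<odot> e \<odot> I d)"
    using exchange[of "I c \<odot> k'" "e \<odot> I d" c "c \<otimes> d \<otimes> q" "p \<otimes> c \<otimes> d" d] by simp
  have 2: "(I c \<odot> e \<odot> I d) \<bullet> (k \<odot> I (c \<otimes> d)) = I (c \<otimes> d)"
    using whisker_right[of "I c \<odot> e" "k \<odot> I c" d] by simp
  have 3: "(I (c \<otimes> d) \<odot> e') \<bullet> (I c \<odot> k' \<odot> I d) = I (c \<otimes> d)"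
    using whisker_left[of "I d \<odot> e'" "k' \<odot> I d" c] by simp
  have 4: "(e \<odot> I (d \<otimes> q \<otimes> p)) \<bullet> (I (p \<otimes> c) \<odot> k' \<odot> I p) = (k' \<odot> I p) \<bullet> (e \<odot> I p)"
    using exchange[of e "k' \<odot> I p" "p \<otimes> c" \<one> p "d \<otimes> q \<otimes> p"] by simp
  have 4: "(I q \<odot> e \<odot> I (d \<otimes> q \<otimes> p)) \<bullet> (I (q \<otimes> p \<otimes> c) \<odot> k' \<odot> I p)
      = (I q \<odot> k' \<odot> I p) \<bullet> (I q \<odot> e \<odot> I p)"
    using arg_cong[OF 4, of "\<lambda>h. I q \<odot> h"] by (simp add: whisker)
  have 5: "(I q \<odot> e \<odot> I p) \<bullet> (I (q \<otimes> p) \<odot> k) = I (q \<otimes> p)"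
    using whisker_left[of "e \<odot> I p" "I p \<odot> k" q] by simp
  have 6: "(e' \<odot> I (q \<otimes> p)) \<bullet> (I q \<odot> k' \<odot> I p) = I (q \<otimes> p)"
    using whisker_right[of "e' \<odot> I q" "I q \<odot> k'" p] by simp
  show ?thesis
    unfolding dual_pair_def
    by (simp add: whisker comp_reduce[OF 1] comp_reduce[OF 4] 2 3 5 6)
qed

end

section \<open>Duals and traces\<close>

context strict_rigid_category
begin

lemma dual_ob [simp]: "x \<in> Ob C \<Longrightarrow> rd x \<in> Ob C" "x \<in> Ob C \<Longrightarrow> ld x \<in> Ob C"
  "x \<in> Ob C \<Longrightarrow> rd (ld x) = x" "x \<in> Ob C \<Longrightarrow> ld (rd x) = x"
  by (simp_all add: rdual_ob ldual_ob rdual_ldual ldual_rdual)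

definition E :: "'a \<Rightarrow> ('a, 'b) arrow" where
  "E x = Arrow (rd x \<otimes> x) (ev x) \<one>"

definition K :: "'a \<Rightarrow> ('a, 'b) arrow" where
  "K x = Arrow \<one> (coev x) (x \<otimes> rd x)"

lemma E_K_sel [simp]:
  "src (E x) = rd x \<otimes> x" "trg (E x) = \<one>" "mor (E x) = ev x"
  "src (K x) = \<one>" "trg (K x) = x \<otimes> rd x" "mor (K x) = coev x"
  by (simp_all add: E_def K_def)

lemma arr_E_K [simp]: "x \<in> Ob C \<Longrightarrow> arr (E x)" "x \<in> Ob C \<Longrightarrow> arr (K x)"
  by (simp_all add: E_def K_def ev_hom coev_hom)

lemma dual_pair_rd: "x \<in> Ob C \<Longrightarrow> dual_pair x (rd x) (E x) (K x)"
  unfolding dual_pair_def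
  by (intro conjI; (simp; fail)?; intro arrow.expand) (simp_all add: rdual_zigzag)

section \<open>Transposed morphisms\<close>

definition dual :: "('a, 'b) arrow \<Rightarrow> ('a, 'b) arrow" where
  "dual f = Arrow (rd (trg f)) (dual_mor C (src f) (trg f) (mor f)) (rd (src f))"

lemma dual_sel [simp]: "src (dual f) = rd (trg f)" "trg (dual f) = rd (src f)"
  by (simp_all add: dual_def)

lemma dual_eq_comparison:
  assumes [simp]: "arr f"
  shows "dual f = comparison (rd (trg f)) (E (trg f) \<bullet> (I (rd (trg f)) \<odot> f)) (rd (src f)) (K (src f))"
proof -
  have "dual f = (E (trg f) \<odot> I (rd (src f))) \<bullet> (I (rd (trg f)) \<odot> f \<odot> I (rd (src f)))
      \<bullet> (I (rd (trg f)) \<odot> K (src f))"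
    by (intro arrow.expand) (simp add: dual_def dual_mor_def)
  then show ?thesis
    by (simp add: comparison_def whisker)
qed

lemma arr_dual [simp]: "arr f \<Longrightarrow> arr (dual f)"
  unfolding dual_eq_comparison by (rule arr_comparison[where c = "src f"]) simp_all

text \<open>A morphism slides around a cap, and by \<open>dual_coev\<close> around a cup, at the
  price of being transposed. The trace identities below are built from these slides, interchange and
  naturality of the pivotal structure.\<close>

lemma ev_dual:
  assumes [simp]: "arr f" "src f = x" "trg f = y"
  shows "E x \<bullet> (dual f \<odot> I x) = E y \<bullet> (I (rd y) \<odot> f)"
  using ev_comparison_dual_pair[OF dual_pair_rd[of x], of "rd y" "E y \<bullet> (I (rd y) \<odot> f)"]
    arr_ob[OF assms(1)] by (simp add: dual_eq_comparison)

lemma dual_coev: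
  assumes [simp]: "arr f" "src f = x" "trg f = y"
  shows "(I y \<odot> dual f) \<bullet> K y = (f \<odot> I (rd x)) \<bullet> K x"
proof -
  have [simp]: "x \<in> Ob C" "y \<in> Ob C" using arr_ob[OF assms(1)] by simp_all
  have 1: "(I (y \<otimes> rd y) \<odot> f) \<bullet> (K y \<odot> I x) = (K y \<odot> I y) \<bullet> f"
    using exchange[of "K y" f \<one> "y \<otimes> rd y" x y] by simp
  have "(I y \<odot> E y) \<bullet> (K y \<odot> I y) = I y"
    using dual_pair_rd[of y] by (simp add: dual_pair_def)
  from comp_reduce[of _ _ "I y" "I y" f, simplified, OF this]
  have "(I y \<odot> E y) \<bullet> (K y \<odot> I y) \<bullet> f = f" by simp
  with comparison_coev[of "rd y" "rd x" x y "E y \<bullet> (I (rd y) \<odot> f)" "K x" "K y"]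
  show ?thesis by (simp add: dual_eq_comparison whisker 1)
qed

text \<open>The witness is the transpose on the other side, which bends \<open>g\<close> back with
  \<open>K q\<close> and \<open>E p\<close>. Left transposes carry no name of their own; where one
  is wanted, this lemma supplies it.\<close>

lemma dual_surj:
  assumes [simp]: "arr g" "src g = rd q" "trg g = rd p" "p \<in> Ob C" "q \<in> Ob C"
  obtains f where "arr f" "src f = p" "trg f = q" "dual f = g"
proof
  define f where "f = (I q \<odot> (E p \<bullet> (g \<odot> I p))) \<bullet> (K q \<odot> I p)"
  show [simp]: "arr f" "src f = p" "trg f = q"
    by (simp_all add: f_def)
  have 1: "E q \<bullet> (I (rd q \<otimes> q) \<odot> (E p \<bullet> (g \<odot> I p))) = (E p \<bullet> (g \<odot> I p)) \<bullet> (E q \<odot> I (rd q \<otimes> p))"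
    using exchange[of "E q" "E p \<bullet> (g \<odot> I p)" "rd q \<otimes> q" \<one> "rd q \<otimes> p" \<one>] by simp
  have 2: "(E q \<odot> I (rd q \<otimes> p)) \<bullet> (I (rd q) \<odot> K q \<odot> I p) = I (rd q \<otimes> p)"
    using whisker_right[of "E q \<odot> I (rd q)" "I (rd q) \<odot> K q" p] dual_pair_rd[of q]
    by (simp add: dual_pair_def)
  show "dual f = g"
  proof (rule dual_pair_cancel[OF dual_pair_rd[of p]])
    have "E p \<bullet> (dual f \<odot> I p) = E q \<bullet> (I (rd q) \<odot> f)"
      by (rule ev_dual) simp_all
    also have "\<dots> = (E q \<bullet> (I (rd q \<otimes> q) \<odot> (E p \<bullet> (g \<odot> I p)))) \<bullet> (I (rd q) \<odot> K q \<odot> I p)"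
      by (simp add: f_def whisker)
    also have "\<dots> = E p \<bullet> (g \<odot> I p)"
      unfolding 1 by (simp add: 2)
    finally show "E p \<bullet> (dual f \<odot> I p) = E p \<bullet> (g \<odot> I p)" .
  qed simp_all
qed

section \<open>The two duals of a tensor product: nested and chosen\<close>

definition NE :: "'a \<Rightarrow> 'a \<Rightarrow> ('a, 'b) arrow" where
  "NE c d = E d \<bullet> (I (rd d) \<odot> E c \<odot> I d)"

definition NK :: "'a \<Rightarrow> 'a \<Rightarrow> ('a, 'b) arrow" where
  "NK c d = (I c \<odot> K d \<odot> I (rd c)) \<bullet> K c"

lemma dual_pair_nested:
  "\<lbrakk>c \<in> Ob C; d \<in> Ob C\<rbrakk> \<Longrightarrow> dual_pair (c \<otimes> d) (rd d \<otimes> rd c) (NE c d) (NK c d)"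
  unfolding NE_def NK_def by (intro dual_pair_tensor dual_pair_rd)

definition DT :: "'a \<Rightarrow> 'a \<Rightarrow> ('a, 'b) arrow" where
  "DT c d = comparison (rd d \<otimes> rd c) (NE c d) (rd (c \<otimes> d)) (K (c \<otimes> d))"

definition DTI :: "'a \<Rightarrow> 'a \<Rightarrow> ('a, 'b) arrow" where
  "DTI c d = comparison (rd (c \<otimes> d)) (E (c \<otimes> d)) (rd d \<otimes> rd c) (NK c d)"

lemma N_sel [simp]:
  assumes "c \<in> Ob C" "d \<in> Ob C"
  shows "arr (NE c d)" "src (NE c d) = rd d \<otimes> rd c \<otimes> c \<otimes> d" "trg (NE c d) = \<one>"
    "arr (NK c d)" "src (NK c d) = \<one>" "trg (NK c d) = c \<otimes> d \<otimes> rd d \<otimes> rd c"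
  using assms by (simp_all add: NE_def NK_def)

lemma DT_sel [simp]:
  assumes "c \<in> Ob C" "d \<in> Ob C"
  shows "arr (DT c d)" "src (DT c d) = rd d \<otimes> rd c" "trg (DT c d) = rd (c \<otimes> d)"
    "arr (DTI c d)" "trg (DTI c d) = rd d \<otimes> rd c" "src (DTI c d) = rd (c \<otimes> d)"
  using assms unfolding DT_def DTI_def
  by (simp_all) (rule arr_comparison[where c = "c \<otimes> d"]; simp)+

lemma ev_DT: "\<lbrakk>c \<in> Ob C; d \<in> Ob C\<rbrakk> \<Longrightarrow> E (c \<otimes> d) \<bullet> (DT c d \<odot> I (c \<otimes> d)) = NE c d"
  unfolding DT_def by (rule ev_comparison_dual_pair[OF dual_pair_rd]) simp_all

lemma DTI_coev: "\<lbrakk>c \<in> Ob C; d \<in> Ob C\<rbrakk> \<Longrightarrow> (I (c \<otimes> d) \<odot> DTI c d) \<bullet> K (c \<otimes> d) = NK c d"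
  unfolding DTI_def by (rule comparison_coev_dual_pair[OF dual_pair_rd]) simp_all

lemma DTI_DT: "\<lbrakk>c \<in> Ob C; d \<in> Ob C\<rbrakk> \<Longrightarrow> DTI c d \<bullet> DT c d = I (rd d \<otimes> rd c)"
  unfolding DTI_def DT_def by (rule comparison_inverse[OF dual_pair_nested dual_pair_rd]) simp_all

lemma mor_DT: 
  assumes "c \<in> Ob C" "d \<in> Ob C"
  shows "mor (DT c d) = dual_tensor C c d" "mor (DTI c d) = dual_tensor_inv C c d"
  using assms by (simp_all add: DT_def DTI_def NE_def NK_def comparison_def dual_tensor_def dual_tensor_inv_def
      dual_comparison_def)

end

section \<open>Pivotal structures and cyclicity of the traces\<close>

locale pivotal_category = strict_rigid_category +
  fixes a :: "'a \<Rightarrow> 'b"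
  assumes pivotal: "pivotal_structure C a"
begin

definition A :: "'a \<Rightarrow> ('a, 'b) arrow" where
  "A x = Arrow x (a x) (rd (rd x))"

lemma A_sel [simp]: "src (A x) = x" "trg (A x) = rd (rd x)" "mor (A x) = a x"
  by (simp_all add: A_def)

lemma a_hom: "x \<in> Ob C \<Longrightarrow> a x \<in> Hom C x (rd (rd x))"
  using pivotal by (auto simp: pivotal_structure_def)

lemma arr_A [simp]: "x \<in> Ob C \<Longrightarrow> arr (A x)"
  by (simp add: A_def a_hom)

lemma A_inverse:
  assumes "x \<in> Ob C"
  obtains B where "arr B" "src B = rd (rd x)" "trg B = x" "B \<bullet> A x = I x" "A x \<bullet> B = I (rd (rd x))"
proof -
  obtain g where "inverse_mor C x (rd (rd x)) (a x) g"
    using pivotal assms by (auto simp: pivotal_structure_def iso_mor_def)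
  with assms show thesis
    by (intro that[of "Arrow (rd (rd x)) g x"] arrow.expand) (simp_all add: inverse_mor_def)
qed

lemma A_natural:
  assumes f: "arr f"
  shows "A (trg f) \<bullet> f = dual (dual f) \<bullet> A (src f)"
proof -
  have "a (trg f) \<cdot> mor f = double_dual_mor C (src f) (trg f) (mor f) \<cdot> a (src f)"
    using pivotal f unfolding pivotal_structure_def arr_def by blast
  then show ?thesis
    by (intro arrow.expand) (simp add: dual_def double_dual_mor_def)
qed

lemma A_tensor:
  assumes "x \<in> Ob C" "y \<in> Ob C"
  shows "A (x \<otimes> y) = dual (DTI x y) \<bullet> DT (rd y) (rd x) \<bullet> (A x \<odot> A y)"
proof -
  have "a (x \<otimes> y) = double_dual_tensor C x y \<cdot> (a x \<boxtimes> a y)"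
    using pivotal assms by (auto simp: pivotal_structure_def)
  then have "A (x \<otimes> y) = (dual (DTI x y) \<bullet> DT (rd y) (rd x)) \<bullet> (A x \<odot> A y)"
    using assms by (intro arrow.expand) (simp add: dual_def double_dual_tensor_def mor_DT)
  with assms show ?thesis by simp
qed

definition TR :: "('a, 'b) arrow \<Rightarrow> ('a, 'b) arrow" where
  "TR f = E (rd (src f)) \<bullet> ((A (src f) \<bullet> f) \<odot> I (rd (src f))) \<bullet> K (src f)"

text \<open>Written with right duals only: \<open>coev' c\<close> is \<open>K (ld c)\<close>, and
  \<open>rd (rd (ld c))\<close> is \<open>rd c\<close>.\<close>

definition TL :: "('a, 'b) arrow \<Rightarrow> ('a, 'b) arrow" where
  "TL f = E (src f) \<bullet> (A (ld (src f)) \<odot> f) \<bullet> K (ld (src f))"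

lemma TR_TL_sel [simp]: "src (TR f) = \<one>" "trg (TR f) = \<one>" "src (TL f) = \<one>" "trg (TL f) = \<one>"
  by (simp_all add: TR_def TL_def)

lemma arr_TR [simp]: "\<lbrakk>arr f; src f = trg f\<rbrakk> \<Longrightarrow> arr (TR f)"
  unfolding TR_def by simp

lemma arr_TL [simp]: "\<lbrakk>arr f; src f = trg f\<rbrakk> \<Longrightarrow> arr (TL f)"
  unfolding TL_def by (simp del: arr_ob add: arr_ob(2))

lemma left_trace_eq: "c \<in> Ob C \<Longrightarrow> left_trace C a c f = mor (TL (Arrow c f c))"
  by (simp add: left_trace_def TL_def coev_ldual)

lemma right_trace_eq: "c \<in> Ob C \<Longrightarrow> right_trace C a c f = mor (TR (Arrow c f c))"
  by (simp add: right_trace_def TR_def)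

text \<open>Naturality moves \<open>f\<close> past the pivotal morphism as its double transpose; it
  slides around the cap as \<open>dual f\<close> and returns around the cup as \<open>f\<close>, now
  behind \<open>g\<close>.\<close>

lemma TR_cyclic:
  assumes [simp]: "arr f" "arr g" "trg f = d" "src f = c" "src g = d" "trg g = c"
  shows "TR (f \<bullet> g) = TR (g \<bullet> f)"
proof -
  have [simp]: "c \<in> Ob C" "d \<in> Ob C"
    using arr_ob[OF assms(1)] by simp_all
  let ?h = "A c \<bullet> g"
  have nat: "A d \<bullet> f \<bullet> g = dual (dual f) \<bullet> ?h"
    using comp_reduce[OF A_natural[of f], of g] by simp
  have 1: "E (rd d) \<bullet> (dual (dual f) \<odot> I (rd d)) = E (rd c) \<bullet> (I (rd (rd c)) \<odot> dual f)"
    by (rule ev_dual) simp_all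
  have 2: "(I (rd (rd c)) \<odot> dual f) \<bullet> (?h \<odot> I (rd d)) = (?h \<odot> I (rd c)) \<bullet> (I d \<odot> dual f)"
    by (rule exchange[symmetric]) simp_all
  have "TR (f \<bullet> g) = E (rd d) \<bullet> (dual (dual f) \<odot> I (rd d)) \<bullet> (?h \<odot> I (rd d)) \<bullet> K d"
    using whisker_right[of "dual (dual f)" ?h "rd d"] by (simp add: TR_def nat)
  also have "\<dots> = E (rd c) \<bullet> (I (rd (rd c)) \<odot> dual f) \<bullet> (?h \<odot> I (rd d)) \<bullet> K d"
    by (rule comp_reduce[OF 1]) simp_all
  also have "\<dots> = E (rd c) \<bullet> (?h \<odot> I (rd c)) \<bullet> (I d \<odot> dual f) \<bullet> K d"
    by (subst comp_reduce[OF 2]) simp_all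
  also have "\<dots> = E (rd c) \<bullet> (?h \<odot> I (rd c)) \<bullet> (f \<odot> I (rd c)) \<bullet> K c"
    by (subst dual_coev[of f c d]) simp_all
  also have "\<dots> = TR (g \<bullet> f)"
    by (simp add: TR_def whisker)
  finally show ?thesis .
qed

text \<open>The same loop in the other direction. To come back around the cup, \<open>f\<close> has
  to be a transpose itself, hence the choice of \<open>f'\<close> with
  \<open>dual f' = f\<close>.\<close>

lemma TL_cyclic:
  assumes [simp]: "arr f" "arr g" "trg f = d" "src f = c" "src g = d" "trg g = c"
  shows "TL (f \<bullet> g) = TL (g \<bullet> f)"
proof -
  have [simp]: "c \<in> Ob C" "d \<in> Ob C"
    using arr_ob[OF assms(1)] by simp_all
  obtain f' where [simp]: "arr f'" "src f' = ld d" "trg f' = ld c" and f: "dual f' = f"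
    by (rule dual_surj[of f "ld c" "ld d"]) simp_all
  have 1: "E d \<bullet> (I (rd d) \<odot> f) = E c \<bullet> (dual f \<odot> I c)"
    by (rule ev_dual[symmetric]) simp_all
  have nat: "dual f \<bullet> A (ld d) = A (ld c) \<bullet> f'"
    using A_natural[of f'] by (simp add: f)
  have "TL (f \<bullet> g) = E d \<bullet> (I (rd d) \<odot> f) \<bullet> (A (ld d) \<odot> g) \<bullet> K (ld d)"
    using ainterchange[of "A (ld d)" "I (rd d)" g f] by (simp add: TL_def)
  also have "\<dots> = E c \<bullet> (dual f \<odot> I c) \<bullet> (A (ld d) \<odot> g) \<bullet> K (ld d)"
    by (rule comp_reduce[OF 1]) simp_all
  also have "\<dots> = E c \<bullet> ((dual f \<bullet> A (ld d)) \<odot> g) \<bullet> K (ld d)"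
    using ainterchange[of "A (ld d)" "dual f" g "I c"] by simp
  also have "\<dots> = E c \<bullet> (A (ld c) \<odot> g) \<bullet> (f' \<odot> I d) \<bullet> K (ld d)"
    using ainterchange[of f' "A (ld c)" "I d" g] by (simp add: nat)
  also have "\<dots> = E c \<bullet> (A (ld c) \<odot> g) \<bullet> (I (ld c) \<odot> f) \<bullet> K (ld c)"
    using dual_coev[of f' "ld d" "ld c"] by (simp add: f)
  also have "\<dots> = TL (g \<bullet> f)"
    using ainterchange[of "I (ld c)" "A (ld c)" f g] by (simp add: TL_def)
  finally show ?thesis .
qed

text \<open>As \<open>ld (rd p) = p\<close>, the cap and cup that close \<open>rd p\<close> on the
  left are those that close \<open>p\<close> on the right; only \<open>dual f\<close> has to slide
  around the cup. This identity relates the left traces of the conjugate to its right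
  traces.\<close>

lemma TL_dual:
  assumes [simp]: "arr f" "src f = p" "trg f = p"
  shows "TL (dual f) = TR f"
proof -
  have [simp]: "p \<in> Ob C" using arr_ob[OF assms(1)] by simp
  have "TL (dual f) = E (rd p) \<bullet> (A p \<odot> I (rd p)) \<bullet> (I p \<odot> dual f) \<bullet> K p"
    using ainterchange[of "I p" "A p" "dual f" "I (rd p)"] by (simp add: TL_def)
  also have "\<dots> = E (rd p) \<bullet> (A p \<odot> I (rd p)) \<bullet> (f \<odot> I (rd p)) \<bullet> K p"
    by (subst dual_coev[of f p p]) simp_all
  also have "\<dots> = TR f"
    by (simp add: TR_def whisker)
  finally show ?thesis .
qed

text \<open>By naturality the pivotal isomorphism conjugates \<open>f\<close> into its double
  transpose, and cyclicity removes the conjugation.\<close>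

lemma TL_dual_dual:
  assumes [simp]: "arr f" "src f = p" "trg f = p"
  shows "TL (dual (dual f)) = TL f"
proof -
  have [simp]: "p \<in> Ob C" using arr_ob[OF assms(1)] by simp
  obtain B where [simp]: "arr B" "src B = rd (rd p)" "trg B = p"
    and B: "B \<bullet> A p = I p" "A p \<bullet> B = I (rd (rd p))"
    by (rule A_inverse[of p]) simp_all
  have "TL (dual (dual f)) = TL ((dual (dual f) \<bullet> A p) \<bullet> B)"
    by (simp add: B)
  also have "\<dots> = TL (A p \<bullet> f \<bullet> B)"
    using A_natural[of f] by (simp flip: acomp_assoc)
  also have "\<dots> = TL (f \<bullet> B \<bullet> A p)"
    by (subst TL_cyclic[of "A p" "f \<bullet> B" "rd (rd p)" p]) simp_all
  also have "\<dots> = TL f" by (simp add: B)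
  finally show ?thesis .
qed

text \<open>Partial traces: \<open>PR\<close> closes the strand \<open>y\<close> on the right, \<open>PL\<close> the strand \<open>d\<close> on the left.\<close>

definition PR :: "'a \<Rightarrow> 'a \<Rightarrow> 'a \<Rightarrow> ('a, 'b) arrow \<Rightarrow> ('a, 'b) arrow" where
  "PR x x' y f = (I x' \<odot> E (rd y)) \<bullet> (((I x' \<odot> A y) \<bullet> f) \<odot> I (rd y)) \<bullet> (I x \<odot> K y)"

definition PL :: "'a \<Rightarrow> 'a \<Rightarrow> 'a \<Rightarrow> ('a, 'b) arrow \<Rightarrow> ('a, 'b) arrow" where
  "PL d x x' f = (E d \<odot> I x') \<bullet> (A (ld d) \<odot> f) \<bullet> (K (ld d) \<odot> I x)"

lemma PR_sel [simp]: "\<lbrakk>x \<in> Ob C; x' \<in> Ob C\<rbrakk> \<Longrightarrow> src (PR x x' y f) = x"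
  "\<lbrakk>x \<in> Ob C; x' \<in> Ob C\<rbrakk> \<Longrightarrow> trg (PR x x' y f) = x'"
  "\<lbrakk>x \<in> Ob C; x' \<in> Ob C; y \<in> Ob C; arr f; src f = x \<otimes> y; trg f = x' \<otimes> y\<rbrakk> \<Longrightarrow> arr (PR x x' y f)"
  by (simp_all add: PR_def)

lemma PL_sel [simp]: "\<lbrakk>x \<in> Ob C; x' \<in> Ob C\<rbrakk> \<Longrightarrow> src (PL d x x' f) = x"
  "\<lbrakk>x \<in> Ob C; x' \<in> Ob C\<rbrakk> \<Longrightarrow> trg (PL d x x' f) = x'"
  "\<lbrakk>x \<in> Ob C; x' \<in> Ob C; d \<in> Ob C; arr f; src f = d \<otimes> x; trg f = d \<otimes> x'\<rbrakk> \<Longrightarrow> arr (PL d x x' f)"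
  by (simp_all add: PL_def)

text \<open>The strand \<open>d\<close> that is closed is disjoint from \<open>v\<close> and
  \<open>t\<close>, so these slide out past the cap and the cup.\<close>

lemma PL_natural:
  assumes [simp]: "d \<in> Ob C" "arr v" "arr t" "arr f" "src f = d \<otimes> x" "trg f = d \<otimes> x'"
    "trg t = x" "src t = y" "src v = x'" "trg v = y'"
  shows "PL d y y' ((I d \<odot> v) \<bullet> f \<bullet> (I d \<odot> t)) = v \<bullet> PL d x x' f \<bullet> t"
proof -
  have [simp]: "x \<in> Ob C" "x' \<in> Ob C" "y \<in> Ob C" "y' \<in> Ob C"
    using arr_ob[of v] arr_ob[of t] by simp_all
  have 1: "A (ld d) \<odot> ((I d \<odot> v) \<bullet> f \<bullet> (I d \<odot> t))
      = (I (rd d \<otimes> d) \<odot> v) \<bullet> (A (ld d) \<odot> f) \<bullet> (I (ld d \<otimes> d) \<odot> t)"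
    using ainterchange[of "A (ld d)" "I (rd d)" "f \<bullet> (I d \<odot> t)" "I d \<odot> v"]
      ainterchange[of "I (ld d)" "A (ld d)" "I d \<odot> t" f] by simp
  have 2: "(I (ld d \<otimes> d) \<odot> t) \<bullet> (K (ld d) \<odot> I y) = (K (ld d) \<odot> I x) \<bullet> t"
    using exchange[of "K (ld d)" t \<one> "ld d \<otimes> d" y x] by simp
  have 3: "(E d \<odot> I y') \<bullet> (I (rd d \<otimes> d) \<odot> v) = v \<bullet> (E d \<odot> I x')"
    using exchange[of "E d" v "rd d \<otimes> d" \<one> x' y'] by simp
  show ?thesis
    unfolding PL_def 1 by (simp add: 2 comp_reduce[OF 3])
qed

lemma PR_natural:
  assumes [simp]: "y \<in> Ob C" "arr v" "arr f" "src f = x \<otimes> y" "trg f = x' \<otimes> y"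
    "src v = x'" "trg v = z" "x \<in> Ob C"
  shows "PR x z y ((v \<odot> I y) \<bullet> f) = v \<bullet> PR x x' y f"
proof -
  have [simp]: "x' \<in> Ob C" "z \<in> Ob C"
    using arr_ob[of v] by simp_all
  have 1: "(I z \<odot> A y) \<bullet> (v \<odot> I y) = (v \<odot> I (rd (rd y))) \<bullet> (I x' \<odot> A y)"
    by (rule exchange[symmetric]) simp_all
  have 2: "(I z \<odot> E (rd y)) \<bullet> (v \<odot> I (rd (rd y) \<otimes> rd y)) = v \<bullet> (I x' \<odot> E (rd y))"
    using exchange[of v "E (rd y)" x' z "rd (rd y) \<otimes> rd y" \<one>] by simp
  show ?thesis
    unfolding PR_def by (simp add: comp_reduce[OF 1] comp_reduce[OF 2] whisker)
qed

text \<open>Closing a strand on the left commutes with closing anything on the right.\<close>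

lemma TL_close_right:
  assumes [simp]: "d \<in> Ob C" "z \<in> Ob C" "z' \<in> Ob C" "w \<in> Ob C" "arr h" "src h = d \<otimes> z" "trg h = d \<otimes> z'"
    "arr k" "src k = \<one>" "trg k = z \<otimes> w" "arr e" "src e = z' \<otimes> w" "trg e = \<one>"
  shows "TL ((I d \<odot> e) \<bullet> (h \<odot> I w) \<bullet> (I d \<odot> k)) = e \<bullet> (PL d z z' h \<odot> I w) \<bullet> k"
proof -
  have 1: "A (ld d) \<odot> ((I d \<odot> e) \<bullet> (h \<odot> I w) \<bullet> (I d \<odot> k))
      = (I (rd d \<otimes> d) \<odot> e) \<bullet> (A (ld d) \<odot> h \<odot> I w) \<bullet> (I (ld d \<otimes> d) \<odot> k)"
    using ainterchange[of "A (ld d)" "I (rd d)" "(h \<odot> I w) \<bullet> (I d \<odot> k)" "I d \<odot> e"]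
      ainterchange[of "I (ld d)" "A (ld d)" "I d \<odot> k" "h \<odot> I w"] by simp
  have 2: "(I (ld d \<otimes> d) \<odot> k) \<bullet> K (ld d) = (K (ld d) \<odot> I (z \<otimes> w)) \<bullet> k"
    using exchange[of "K (ld d)" k \<one> "ld d \<otimes> d" \<one> "z \<otimes> w"] by simp
  have 3: "E d \<bullet> (I (rd d \<otimes> d) \<odot> e) = e \<bullet> (E d \<odot> I (z' \<otimes> w))"
    using exchange[of "E d" e "rd d \<otimes> d" \<one> "z' \<otimes> w" \<one>] by simp
  show ?thesis
    by (simp add: TL_def PL_def 1 2 comp_reduce[OF 3] whisker)
qed

section \<open>Multiplicativity of the traces\<close>

lemma ev_double_dual_tensor:
  assumes [simp]: "x \<in> Ob C" "y \<in> Ob C"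
  shows "E (rd (x \<otimes> y)) \<bullet> ((dual (DTI x y) \<bullet> DT (rd y) (rd x)) \<odot> I (rd (x \<otimes> y)))
    = NE (rd y) (rd x) \<bullet> (I (rd (rd x) \<otimes> rd (rd y)) \<odot> DTI x y)"
proof -
  have 1: "E (rd (x \<otimes> y)) \<bullet> (dual (DTI x y) \<odot> I (rd (x \<otimes> y)))
      = E (rd y \<otimes> rd x) \<bullet> (I (rd (rd y \<otimes> rd x)) \<odot> DTI x y)"
    by (rule ev_dual) simp_all
  have 2: "(I (rd (rd y \<otimes> rd x)) \<odot> DTI x y) \<bullet> (DT (rd y) (rd x) \<odot> I (rd (x \<otimes> y)))
     = (DT (rd y) (rd x) \<odot> I (rd y \<otimes> rd x)) \<bullet> (I (rd (rd x) \<otimes> rd (rd y)) \<odot> DTI x y)"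
    by (rule exchange[symmetric]) simp_all
  show ?thesis
    using comp_reduce1[OF ev_DT[of "rd y" "rd x"]]
    by (simp add: whisker comp_reduce[OF 1] 2)
qed

text \<open>Under the cap, the structure map of the double dual becomes the nested cap of
  \<open>rd y\<close> and \<open>rd x\<close> preceded by \<open>DTI x y\<close>. That comparison
  slides down to the cup and makes it nested as well. The inner loop is then the partial trace over
  \<open>y\<close>, the outer one the trace over \<open>x\<close>.\<close>

lemma TR_tensor:
  assumes [simp]: "x \<in> Ob C" "y \<in> Ob C" "arr u" "src u = x \<otimes> y" "trg u = x \<otimes> y"
  shows "TR u = TR (PR x x y u)"
proof -
  let ?r = "rd (x \<otimes> y)"
  let ?v = "(A x \<odot> A y) \<bullet> u"
  have A: "A (x \<otimes> y) = (dual (DTI x y) \<bullet> DT (rd y) (rd x)) \<bullet> (A x \<odot> A y)"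
    by (simp add: A_tensor)
  have 1: "(I (rd (rd x) \<otimes> rd (rd y)) \<odot> DTI x y) \<bullet> (?v \<odot> I ?r)
      = (?v \<odot> I (rd y \<otimes> rd x)) \<bullet> (I (x \<otimes> y) \<odot> DTI x y)"
    by (rule exchange[symmetric]) simp_all
  have 2: "A x \<odot> I (rd (rd y)) \<odot> I (rd y \<otimes> rd x) = A x \<odot> I (rd (rd y) \<otimes> rd y \<otimes> rd x)"
    by simp
  have 3: "(I (rd (rd x)) \<odot> E (rd y) \<odot> I (rd x)) \<bullet> (A x \<odot> I (rd (rd y) \<otimes> rd y \<otimes> rd x))
      = (A x \<odot> I (rd x)) \<bullet> (I x \<odot> E (rd y) \<odot> I (rd x))"
    using exchange[of "A x" "E (rd y) \<odot> I (rd x)" x "rd (rd x)" "rd (rd y) \<otimes> rd y \<otimes> rd x" "rd x"]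
    by simp
  have "TR u = (E ?r \<bullet> ((dual (DTI x y) \<bullet> DT (rd y) (rd x)) \<odot> I ?r)) \<bullet> (?v \<odot> I ?r) \<bullet> K (x \<otimes> y)"
    unfolding TR_def assms(4) A by (simp add: whisker)
  also have "\<dots> = NE (rd y) (rd x) \<bullet> (I (rd (rd x) \<otimes> rd (rd y)) \<odot> DTI x y) \<bullet> (?v \<odot> I ?r) \<bullet> K (x \<otimes> y)"
    unfolding ev_double_dual_tensor[OF assms(1,2)] by simp
  also have "\<dots> = NE (rd y) (rd x) \<bullet> (?v \<odot> I (rd y \<otimes> rd x)) \<bullet> (I (x \<otimes> y) \<odot> DTI x y) \<bullet> K (x \<otimes> y)"
    by (subst comp_reduce[OF 1]) simp_all
  also have "\<dots> = NE (rd y) (rd x) \<bullet> (?v \<odot> I (rd y \<otimes> rd x)) \<bullet> NK x y"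
    by (simp add: DTI_coev)
  also have "A x \<odot> A y = (A x \<odot> I (rd (rd y))) \<bullet> (I x \<odot> A y)"
    by (simp add: tensor_left_last)
  also have "NE (rd y) (rd x) \<bullet> ((((A x \<odot> I (rd (rd y))) \<bullet> (I x \<odot> A y)) \<bullet> u) \<odot> I (rd y \<otimes> rd x)) \<bullet> NK x y
      = TR (PR x x y u)"
    by (simp add: NE_def NK_def TR_def PR_def whisker 2 comp_reduce[OF 3])
  finally show ?thesis .
qed

text \<open>The pivotal morphism occurs at \<open>ld (x \<otimes> y)\<close>, which is only
  isomorphic to \<open>ld y \<otimes> ld x\<close>. Naturality along \<open>\<phi>\<close>, the left
  transpose of a comparison, carries the tensor formula over; afterwards cap and cup are nested and
  the inner loop closes \<open>x\<close>.\<close>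

lemma TL_tensor:
  assumes [simp]: "x \<in> Ob C" "y \<in> Ob C" "arr u" "src u = x \<otimes> y" "trg u = x \<otimes> y"
  shows "TL u = TL (PL x y y u)"
proof -
  define p q r where "p = ld x" and "q = ld y" and "r = ld (x \<otimes> y)"
  have [simp]: "p \<in> Ob C" "q \<in> Ob C" "r \<in> Ob C" "rd p = x" "rd q = y" "rd r = x \<otimes> y"
    "ld x = p" "ld y = q" "ld (x \<otimes> y) = r"
    by (simp_all add: p_def q_def r_def)
  obtain \<phi> where [simp]: "arr \<phi>" "src \<phi> = r" "trg \<phi> = q \<otimes> p" and \<phi>: "dual \<phi> = DTI q p"
    by (rule dual_surj[of "DTI q p" "q \<otimes> p" r]) simp_all
  have coev: "(\<phi> \<odot> I (x \<otimes> y)) \<bullet> K r = NK q p"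
    using dual_coev[of \<phi> r "q \<otimes> p"] DTI_coev[of q p] by (simp add: \<phi>)
  \<comment> \<open>This is the transpose of \<open>DTI_DT\<close>. It is obtained by letting
    \<open>DT q p\<close> and \<open>DTI q p\<close> slide around caps, where they cancel.\<close>
  have inv: "dual (DT q p) \<bullet> dual (DTI q p) = I (rd (x \<otimes> y))"
  proof (rule dual_pair_cancel[OF dual_pair_rd[of "x \<otimes> y"]])
    have 1: "E (x \<otimes> y) \<bullet> (dual (DT q p) \<odot> I (x \<otimes> y)) = E (rd (q \<otimes> p)) \<bullet> (I (rd (rd (q \<otimes> p))) \<odot> DT q p)"
      by (rule ev_dual) simp_all
    have 2: "E (rd (q \<otimes> p)) \<bullet> (dual (DTI q p) \<odot> I (rd (q \<otimes> p))) = E (x \<otimes> y) \<bullet> (I (rd (x \<otimes> y)) \<odot> DTI q p)"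
      by (rule ev_dual) simp_all
    have 3: "(I (rd (rd (q \<otimes> p))) \<odot> DT q p) \<bullet> (dual (DTI q p) \<odot> I (x \<otimes> y))
        = (dual (DTI q p) \<odot> I (rd (q \<otimes> p))) \<bullet> (I (rd (x \<otimes> y)) \<odot> DT q p)"
      by (rule exchange[symmetric]) simp_all
    have 4: "(I (rd (x \<otimes> y)) \<odot> DTI q p) \<bullet> (I (rd (x \<otimes> y)) \<odot> DT q p) = I (rd (x \<otimes> y) \<otimes> x \<otimes> y)"
      using whisker_left[of "DTI q p" "DT q p" "rd (x \<otimes> y)"] DTI_DT[of q p] by simp
    show "E (x \<otimes> y) \<bullet> ((dual (DT q p) \<bullet> dual (DTI q p)) \<odot> I (x \<otimes> y))
        = E (x \<otimes> y) \<bullet> (I (rd (x \<otimes> y)) \<odot> I (x \<otimes> y))"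
      by (simp add: whisker comp_reduce[OF 1] 3 comp_reduce[OF 2] 4)
  qed simp_all
  have "dual (DTI q p) \<bullet> DT x y \<bullet> (A q \<odot> A p) \<bullet> \<phi> = A (q \<otimes> p) \<bullet> \<phi>"
    by (simp add: A_tensor)
  also have "\<dots> = dual (DTI q p) \<bullet> A r"
    using A_natural[of \<phi>] by (simp add: \<phi>)
  finally have "(dual (DT q p) \<bullet> dual (DTI q p)) \<bullet> DT x y \<bullet> (A q \<odot> A p) \<bullet> \<phi>
      = (dual (DT q p) \<bullet> dual (DTI q p)) \<bullet> A r"
    by simp
  then have A: "A r = DT x y \<bullet> (A q \<odot> A p) \<bullet> \<phi>"
    unfolding inv by simp
  have 1: "E (x \<otimes> y) \<bullet> (DT x y \<odot> I (x \<otimes> y)) = NE x y"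
    by (rule ev_DT) simp_all
  have "TL u = E (x \<otimes> y) \<bullet> ((DT x y \<bullet> (A q \<odot> A p) \<bullet> \<phi>) \<odot> u) \<bullet> K r"
    by (simp add: TL_def A)
  also have "\<dots> = E (x \<otimes> y) \<bullet> (DT x y \<odot> I (x \<otimes> y)) \<bullet> (((A q \<odot> A p) \<bullet> \<phi>) \<odot> u) \<bullet> K r"
    using ainterchange[of "(A q \<odot> A p) \<bullet> \<phi>" "DT x y" u "I (x \<otimes> y)"] by simp
  also have "\<dots> = NE x y \<bullet> (((A q \<odot> A p) \<bullet> \<phi>) \<odot> u) \<bullet> K r"
    by (rule comp_reduce1[OF 1]) simp_all
  also have "\<dots> = NE x y \<bullet> ((A q \<odot> A p) \<odot> u) \<bullet> (\<phi> \<odot> I (x \<otimes> y)) \<bullet> K r"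
    using ainterchange[of \<phi> "A q \<odot> A p" "I (x \<otimes> y)" u] by simp
  also have "\<dots> = NE x y \<bullet> (A q \<odot> A p \<odot> u) \<bullet> NK q p"
    by (simp add: coev)
  also have "\<dots> = E y \<bullet> ((I (rd y) \<odot> E x \<odot> I y) \<bullet> (A q \<odot> A p \<odot> u) \<bullet> (I q \<odot> K p \<odot> I y)) \<bullet> K q"
    by (simp add: NE_def NK_def)
  also have "(I (rd y) \<odot> E x \<odot> I y) \<bullet> (A q \<odot> A p \<odot> u) \<bullet> (I q \<odot> K p \<odot> I y) = A q \<odot> PL x y y u"
    using ainterchange[of "A q" "I (rd y)" "(A p \<odot> u) \<bullet> (K p \<odot> I y)" "E x \<odot> I y"]
      ainterchange[of "I q" "A q" "K p \<odot> I y" "A p \<odot> u"]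
    by (simp add: PL_def)
  also have "E y \<bullet> (A q \<odot> PL x y y u) \<bullet> K q = TL (PL x y y u)"
    by (simp add: TL_def)
  finally show ?thesis by simp
qed

text \<open>Loops on opposite sides do not interact: \<open>TL_close_right\<close> is applied with
  the right closure of \<open>y\<close> as \<open>e\<close> and \<open>k\<close>.\<close>

lemma TR_TL_swap:
  assumes [simp]: "x \<in> Ob C" "y \<in> Ob C" "arr u" "src u = x \<otimes> y" "trg u = x \<otimes> y"
  shows "TR (PL x y y u) = TL (PR x x y u)"
proof -
  have 1: "PR x x y u = (I x \<odot> (E (rd y) \<bullet> (A y \<odot> I (rd y)))) \<bullet> (u \<odot> I (rd y)) \<bullet> (I x \<odot> K y)"
    by (simp add: PR_def whisker)
  have "TL (PR x x y u) = (E (rd y) \<bullet> (A y \<odot> I (rd y))) \<bullet> (PL x y y u \<odot> I (rd y)) \<bullet> K y"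
    unfolding 1 by (rule TL_close_right) simp_all
  also have "\<dots> = TR (PL x y y u)"
    by (simp add: TR_def whisker)
  finally show ?thesis by simp
qed

end

section \<open>Schur's lemma and semisimplicity\<close>

context linear_category
begin

interpretation vs: vector_space "Scale C"
  by (rule scale_vector_space)

lemma hom_zero: "\<lbrakk>x \<in> Ob C; y \<in> Ob C\<rbrakk> \<Longrightarrow> 0 \<in> Hom C x y"
  using hom_subspace vs.subspace_0 by blast

lemma hom_add: "\<lbrakk>x \<in> Ob C; y \<in> Ob C; f \<in> Hom C x y; g \<in> Hom C x y\<rbrakk> \<Longrightarrow> f + g \<in> Hom C x y"
  using hom_subspace vs.subspace_add by blast

lemma hom_diff: "\<lbrakk>x \<in> Ob C; y \<in> Ob C; f \<in> Hom C x y; g \<in> Hom C x y\<rbrakk> \<Longrightarrow> f - g \<in> Hom C x y"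
  using hom_subspace vs.subspace_diff by blast

lemma hom_scale: "\<lbrakk>x \<in> Ob C; y \<in> Ob C; f \<in> Hom C x y\<rbrakk> \<Longrightarrow> Scale C r f \<in> Hom C x y"
  using hom_subspace vs.subspace_scale by blast

lemma hom_sum: "\<lbrakk>x \<in> Ob C; y \<in> Ob C; \<And>k. k \<in> S \<Longrightarrow> f k \<in> Hom C x y\<rbrakk> \<Longrightarrow> sum f S \<in> Hom C x y"
  using hom_subspace vs.subspace_sum by blast

lemma comp_zero_left:
  assumes "x \<in> Ob C" "y \<in> Ob C" "z \<in> Ob C" "f \<in> Hom C x y"
  shows "0 \<cdot> f = 0"
  using comp_add_left[OF assms hom_zero hom_zero] assms by simp

lemma comp_zero_right:
  assumes "x \<in> Ob C" "y \<in> Ob C" "z \<in> Ob C" "g \<in> Hom C y z"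
  shows "g \<cdot> 0 = 0"
  using comp_add_right[OF assms(1-3) hom_zero hom_zero assms(4)] assms by simp

lemma comp_diff_left:
  assumes "x \<in> Ob C" "y \<in> Ob C" "z \<in> Ob C" "f \<in> Hom C x y" "g \<in> Hom C y z" "g' \<in> Hom C y z"
  shows "(g - g') \<cdot> f = g \<cdot> f - g' \<cdot> f"
  using comp_add_left[OF assms(1-4) hom_diff[OF assms(2,3,5,6)] assms(6)] by simp

lemma comp_diff_right:
  assumes "x \<in> Ob C" "y \<in> Ob C" "z \<in> Ob C" "f \<in> Hom C x y" "f' \<in> Hom C x y" "g \<in> Hom C y z"
  shows "g \<cdot> (f - f') = g \<cdot> f - g \<cdot> f'"
  using comp_add_right[OF assms(1-3) hom_diff[OF assms(1,2,4,5)] assms(5,6)] by simp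

lemma comp_sum_left:
  assumes "x \<in> Ob C" "y \<in> Ob C" "z \<in> Ob C" "f \<in> Hom C x y" "\<And>k. k \<in> S \<Longrightarrow> g k \<in> Hom C y z"
  shows "sum g S \<cdot> f = (\<Sum>k\<in>S. g k \<cdot> f)"
  using assms(5)
  by (induction S rule: infinite_finite_induct)
    (simp_all add: comp_zero_left[OF assms(1-4)] comp_add_left[OF assms(1-4)] hom_sum assms)

lemma comp_sum_right:
  assumes "x \<in> Ob C" "y \<in> Ob C" "z \<in> Ob C" "g \<in> Hom C y z" "\<And>k. k \<in> S \<Longrightarrow> f k \<in> Hom C x y"
  shows "g \<cdot> sum f S = (\<Sum>k\<in>S. g \<cdot> f k)"
  using assms(5)
  by (induction S rule: infinite_finite_induct)
    (simp_all add: comp_zero_right[OF assms(1-4)] comp_add_right[OF assms(1-3) _ _ assms(4)] hom_sum assms)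

lemma inverse_mor_unique:
  assumes ob: "x \<in> Ob C" "y \<in> Ob C" and g: "inverse_mor C x y f g" "inverse_mor C x y f g'"
  shows "g = g'"
proof -
  have "g = (g' \<cdot> f) \<cdot> g"
    using g id_left[OF ob(2,1)] by (simp add: inverse_mor_def)
  also have "\<dots> = g'"
    using g comp_assoc[OF ob(2,1,2,1), of g f g'] id_right[OF ob(2,1)] by (simp add: inverse_mor_def)
  finally show ?thesis .
qed

lemma inv_mor:
  assumes "x \<in> Ob C" "y \<in> Ob C" "iso_mor C x y f"
  shows "inverse_mor C x y f (inv_mor C x y f)"
  unfolding inv_mor_def using assms inverse_mor_unique[OF assms(1,2)]
  by (metis iso_mor_def theI)

lemma inverse_mor_sym: "inverse_mor C x y f g \<Longrightarrow> inverse_mor C y x g f"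
  by (simp add: inverse_mor_def)

lemma zero_object_iff: "zero_object C x \<longleftrightarrow> x \<in> Ob C \<and> id x = 0"
proof
  assume "zero_object C x"
  then show "x \<in> Ob C \<and> id x = 0"
    using id_hom[of x] by (auto simp: zero_object_def)
next
  assume x: "x \<in> Ob C \<and> id x = 0"
  have "f = 0" if "y \<in> Ob C" "f \<in> Hom C x y" for f y
    using id_right[of x y f] comp_zero_right[of x x y f] x that by simp
  moreover have "f = 0" if "y \<in> Ob C" "f \<in> Hom C y x" for f y
    using id_left[of y x f] comp_zero_left[of y x x f] x that by simp
  ultimately show "zero_object C x"
    using x by (auto simp: zero_object_def hom_zero)
qed

lemma simple_id_nonzero: "simple_object C s \<Longrightarrow> id s \<noteq> 0"
  by (auto simp: simple_object_def zero_object_iff)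

lemma mono_morI:
  assumes "x \<in> Ob C" "y \<in> Ob C" "f \<in> Hom C x y"
    and "\<And>w g. \<lbrakk>w \<in> Ob C; g \<in> Hom C w x; f \<cdot> g = 0\<rbrakk> \<Longrightarrow> g = 0"
  shows "mono_mor C x y f"
  unfolding mono_mor_def
proof (intro conjI ballI impI)
  fix w g h
  assume w: "w \<in> Ob C" "g \<in> Hom C w x" "h \<in> Hom C w x" "f \<cdot> g = f \<cdot> h"
  then have "f \<cdot> (g - h) = 0"
    using comp_diff_right[OF w(1) assms(1,2) w(2,3) assms(3)] by simp
  then have "g - h = 0"
    using assms hom_diff w by blast
  then show "g = h" by simp
qed (use assms in simp)

lemma kernel_mono:
  assumes k: "kernel_mor C w x y k f" and ob: "w \<in> Ob C" "x \<in> Ob C" "y \<in> Ob C"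
  shows "mono_mor C w x k"
proof (rule mono_morI)
  show "k \<in> Hom C w x" using k by (simp add: kernel_mor_def)
  fix v g assume v: "v \<in> Ob C" "g \<in> Hom C v w" "k \<cdot> g = 0"
  have "f \<cdot> 0 = 0" "k \<cdot> 0 = 0" and 0: "0 \<in> Hom C v x" "0 \<in> Hom C v w"
    using k ob v by (auto simp: kernel_mor_def hom_zero intro: comp_zero_right)
  then show "g = 0"
    using k v unfolding kernel_mor_def by blast
qed (use ob in simp_all)

end

context linear_abelian_category
begin

text \<open>The kernel of \<open>f\<close> is a subobject of the simple object \<open>s\<close>. It
  is not all of \<open>s\<close>, as \<open>f\<close> is nonzero, so it vanishes and
  \<open>f\<close> is mono; a mono from a nonzero object into a simple one is an
  isomorphism.\<close>

lemma schur_iso: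
  assumes s: "simple_object C s" and t: "simple_object C t" and f: "f \<in> Hom C s t" "f \<noteq> 0"
  shows "iso_mor C s t f"
proof -
  have ob: "s \<in> Ob C" "t \<in> Ob C" using s t by (simp_all add: simple_object_def)
  obtain w k where w: "w \<in> Ob C" and k: "kernel_mor C w s t k f"
    using kernel_exists[OF ob f(1)] by blast
  then have kh: "k \<in> Hom C w s" and fk: "f \<cdot> k = 0" by (auto simp: kernel_mor_def)
  have "\<not> iso_mor C w s k"
  proof
    assume "iso_mor C w s k"
    then obtain g where g: "g \<in> Hom C s w" "k \<cdot> g = id s"
      by (auto simp: iso_mor_def inverse_mor_def)
    have "f = (f \<cdot> k) \<cdot> g"
      using comp_assoc[OF ob(1) w ob g(1) kh f(1)] id_right[OF ob f(1)] g by simp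
    then show False
      using f(2) fk comp_zero_left[OF ob(1) w ob(2) g(1)] by simp
  qed
  moreover have "mono_mor C w s k"
    by (rule kernel_mono[OF k w ob])
  ultimately have w0: "zero_object C w"
    using s w by (auto simp: simple_object_def)
  have "mono_mor C s t f"
  proof (rule mono_morI[OF ob f(1)])
    fix v g assume v: "v \<in> Ob C" "g \<in> Hom C v s" "f \<cdot> g = 0"
    then obtain u where "u \<in> Hom C v w" "k \<cdot> u = g"
      using k unfolding kernel_mor_def by blast
    moreover from this have "u = 0"
      using w0 v by (auto simp: zero_object_def)
    ultimately show "g = 0"
      using comp_zero_right[OF v(1) w ob(1) kh] by simp
  qed
  moreover have "\<not> zero_object C s" using s by (simp add: simple_object_def)
  ultimately show ?thesis
    using t ob by (auto simp: simple_object_def)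
qed

end

section \<open>Polynomials in an endomorphism\<close>

context linear_category
begin

interpretation vs: vector_space "Scale C"
  by (rule scale_vector_space)

text \<open>Evaluation of \<open>p\<close> at \<open>f\<close> by Horner's scheme, with composition
  as product. The endomorphisms of \<open>x\<close> form a subset of the ambient space and not a
  ring type, so \<open>poly\<close> does not apply.\<close>

definition poly_mor :: "'o \<Rightarrow> 'm \<Rightarrow> complex poly \<Rightarrow> 'm" where
  "poly_mor x f p = fold_coeffs (\<lambda>r g. Scale C r (id x) + f \<cdot> g) p 0"

context
  fixes x f
  assumes x: "x \<in> Ob C" and f: "f \<in> Hom C x x"
begin

lemma poly_mor_0: "poly_mor x f 0 = 0"
  by (simp add: poly_mor_def)

lemma poly_mor_pCons: "poly_mor x f (pCons r p) = Scale C r (id x) + f \<cdot> poly_mor x f p"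
proof (cases "p = 0 \<and> r = 0")
  case True
  then show ?thesis using comp_zero_right[OF x x x f] by (simp add: poly_mor_0)
next
  case False
  then show ?thesis by (auto simp: poly_mor_def)
qed

lemma poly_mor_hom: "poly_mor x f p \<in> Hom C x x"
  by (induction p) (simp_all add: poly_mor_0 poly_mor_pCons hom_zero hom_add hom_scale id_hom x
      comp_hom[OF x x x _ f])

lemma poly_mor_add: "poly_mor x f (p + q) = poly_mor x f p + poly_mor x f q"
proof (induction p q rule: poly_induct2)
  case (pCons r p s q)
  then show ?case
    by (simp add: poly_mor_pCons vs.scale_left_distrib comp_add_right[OF x x x poly_mor_hom poly_mor_hom f])
qed (simp add: poly_mor_0)

lemma poly_mor_smult: "poly_mor x f (smult r p) = Scale C r (poly_mor x f p)"
  by (induction p) (simp_all add: poly_mor_0 poly_mor_pCons vs.scale_right_distrib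
      comp_scale_right[OF x x x poly_mor_hom f])

lemma poly_mor_sum: "poly_mor x f (sum p S) = (\<Sum>k\<in>S. poly_mor x f (p k))"
  by (induction S rule: infinite_finite_induct) (simp_all add: poly_mor_0 poly_mor_add)

lemma poly_mor_root_factor: "poly_mor x f ([:- z, 1:] * q) = (f - Scale C z (id x)) \<cdot> poly_mor x f q"
proof -
  have "[:- z, 1:] * q = smult (- z) q + pCons 0 q"
    by simp
  then have "poly_mor x f ([:- z, 1:] * q) = f \<cdot> poly_mor x f q - Scale C z (poly_mor x f q)"
    by (simp only: poly_mor_add poly_mor_smult poly_mor_pCons) simp
  also have "\<dots> = (f - Scale C z (id x)) \<cdot> poly_mor x f q"
    by (simp add: comp_diff_left[OF x x x poly_mor_hom f hom_scale[OF x x id_hom[OF x]]]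
        comp_scale_left[OF x x x poly_mor_hom id_hom[OF x]] id_left[OF x x poly_mor_hom])
  finally show ?thesis .
qed

lemma annihilating_polynomial:
  assumes B: "finite B" "Hom C x x = vs.span B"
  obtains p where "p \<noteq> 0" "poly_mor x f p = 0"
proof -
  let ?e = "\<lambda>k. poly_mor x f (monom 1 k)"
  show thesis
  \<comment> \<open>Linear dependence is a property of sets, so coinciding powers of
    \<open>f\<close> form a case of their own. If all powers differ, they are infinitely many
    vectors in a finite-dimensional space.\<close>
  proof (cases "inj ?e")
    case False
    then obtain j k where "j \<noteq> k" "?e j = ?e k"
      by (auto simp: inj_def)
    then have "poly_mor x f (monom 1 j + smult (- 1) (monom 1 k)) = 0"
      unfolding poly_mor_add poly_mor_smult by simp
    moreover have "coeff (monom 1 j + smult (- 1) (monom 1 k)) j = (1 :: complex)"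
      using \<open>j \<noteq> k\<close> by simp
    ultimately show thesis
      using that by (metis coeff_0 zero_neq_one)
  next
    case True
    then have "infinite (range ?e)"
      using finite_imageD by blast
    moreover have "range ?e \<subseteq> vs.span B"
      using B poly_mor_hom by auto
    ultimately have "vs.dependent (range ?e)"
      using vs.independent_span_bound[OF B(1)] by blast
    then obtain T u v where T: "finite T" "T \<subseteq> range ?e" "(\<Sum>v\<in>T. Scale C (u v) v) = 0"
      and v: "v \<in> T" "u v \<noteq> 0"
      unfolding vs.dependent_explicit by blast
    define S where "S = ?e -` T"
    have S: "finite S" "T = ?e ` S"
      using T finite_vimageI[OF T(1) True] by (auto simp: S_def)
    let ?p = "\<Sum>k\<in>S. smult (u (?e k)) (monom 1 k)"
    have "poly_mor x f ?p = (\<Sum>k\<in>S. Scale C (u (?e k)) (?e k))"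
      by (simp only: poly_mor_sum poly_mor_smult)
    also have "\<dots> = (\<Sum>v\<in>T. Scale C (u v) v)"
      unfolding S(2) using True by (subst sum.reindex) (auto intro: inj_on_subset)
    finally have "poly_mor x f ?p = 0" using T by simp
    moreover obtain k where k: "k \<in> S" "v = ?e k" using v S by auto
    have "coeff ?p k = u (?e k)"
      using S k by (simp add: coeff_sum if_distrib cong: if_cong)
    then have "?p \<noteq> 0"
      using v k by (metis coeff_0)
    ultimately show thesis using that by blast
  qed
qed

end
end

section \<open>Endomorphisms of simple objects and splittings\<close>

context fusion_category
begin

interpretation vs: vector_space "Scale C"
  by (rule scale_vector_space)

lemma simple_ob: "simple_object C s \<Longrightarrow> s \<in> Ob C"
  by (simp add: simple_object_def)

text \<open>Induction on the degree of an annihilating polynomial. Over the complex numbers it has a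
  root \<open>z\<close>. Either \<open>f\<close> is the scalar \<open>z\<close>, or \<open>f\<close>
  minus that scalar is invertible by Schur's lemma and the linear factor can be cancelled. A nonzero
  constant cannot annihilate, because the identity of a simple object is nonzero.\<close>

lemma schur_scalar:
  assumes s: "simple_object C s" and f: "f \<in> Hom C s s"
  obtains z where "f = Scale C z (id s)"
proof -
  note ob = simple_ob[OF s]
  have "\<exists>z. f = Scale C z (id s)" if "p \<noteq> 0" "poly_mor s f p = 0" for p
    using that
  proof (induction "degree p" arbitrary: p rule: less_induct)
    case less
    have "degree p \<noteq> 0"
    proof
      assume "degree p = 0"
      then obtain r where r: "p = [:r:]" by (metis degree_eq_zeroE)
      then have "Scale C r (id s) = 0"
        using less.prems(2) comp_zero_right[OF ob ob ob f]
        by (simp add: poly_mor_pCons[OF ob f] poly_mor_0[OF ob f])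
      then show False
        using less.prems(1) r simple_id_nonzero[OF s] by simp
    qed
    then obtain z where "poly p z = 0"
      using fundamental_theorem_of_algebra constant_degree by metis
    then obtain q where q: "p = [:- z, 1:] * q"
      using poly_eq_0_iff_dvd by blast
    with less.prems have "q \<noteq> 0" by auto
    then have deg: "degree q < degree p"
      unfolding q by (subst degree_mult_eq) auto
    let ?g = "f - Scale C z (id s)"
    have g: "?g \<in> Hom C s s"
      by (intro hom_diff hom_scale id_hom ob f)
    have gq: "?g \<cdot> poly_mor s f q = 0"
      using less.prems q poly_mor_root_factor[OF ob f] by metis
    show ?case
    proof (cases "?g = 0")
      case True
      then show ?thesis by auto
    next
      case False
      then obtain h where h: "h \<in> Hom C s s" "h \<cdot> ?g = id s"
        using schur_iso[OF s s g] by (auto simp: iso_mor_def inverse_mor_def)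
      have "poly_mor s f q = h \<cdot> ?g \<cdot> poly_mor s f q"
        using comp_assoc[OF ob ob ob ob poly_mor_hom[OF ob f, of q] g h(1)]
          id_left[OF ob ob poly_mor_hom[OF ob f, of q]] h(2) by simp
      also have "\<dots> = 0"
        unfolding gq by (rule comp_zero_right[OF ob ob ob h(1)])
      finally show ?thesis
        using less.hyps[OF deg \<open>q \<noteq> 0\<close>] by simp
    qed
  qed
  moreover obtain B where "finite B" "Hom C s s = vs.span B"
    using hom_finite_dim[OF ob ob] by blast
  then obtain p where "p \<noteq> 0" "poly_mor s f p = 0"
    by (rule annihilating_polynomial[OF ob f])
  ultimately show thesis using that by blast
qed

lemma semisimple_decomposition:
  assumes "x \<in> Ob C"
  obtains n :: nat and s \<iota> \<pi> where "\<And>k. k < n \<Longrightarrow> simple_object C (s k)"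
    "\<And>k. k < n \<Longrightarrow> \<iota> k \<in> Hom C (s k) x" "\<And>k. k < n \<Longrightarrow> \<pi> k \<in> Hom C x (s k)"
    "(\<Sum>k<n. \<iota> k \<cdot> \<pi> k) = id x"
proof -
  obtain n s \<iota> \<pi> where "direct_sum C n s \<iota> \<pi> x" "\<forall>k<n. simple_object C (s k)"
    using semisimple assms unfolding semisimple_def by blast
  then show thesis
    by (intro that[of n s \<iota> \<pi>]) (simp_all add: direct_sum_def)
qed

text \<open>Some component of \<open>f\<close> in a simple summand of \<open>d\<close> is nonzero,
  hence invertible; its inverse after the projection is the retraction.\<close>

lemma simple_split_mono:
  assumes s: "simple_object C s" and d: "d \<in> Ob C" and f: "f \<in> Hom C s d" "f \<noteq> 0"
  obtains g where "g \<in> Hom C d s" "g \<cdot> f = id s"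
proof -
  note so = simple_ob[OF s]
  obtain n :: nat and t \<iota> \<pi> where t: "\<And>k. k < n \<Longrightarrow> simple_object C (t k)"
    and i: "\<And>k. k < n \<Longrightarrow> \<iota> k \<in> Hom C (t k) d" and p: "\<And>k. k < n \<Longrightarrow> \<pi> k \<in> Hom C d (t k)"
    and sum: "(\<Sum>k<n. \<iota> k \<cdot> \<pi> k) = id d"
    by (rule semisimple_decomposition[OF d]) blast
  have "\<exists>k<n. \<pi> k \<cdot> f \<noteq> 0"
  proof (rule ccontr)
    assume *: "\<not> (\<exists>k<n. \<pi> k \<cdot> f \<noteq> 0)"
    have ip: "\<iota> k \<cdot> \<pi> k \<in> Hom C d d" if "k < n" for k
      using comp_hom[OF d simple_ob[OF t] d p i] that by blast
    have "f = (\<Sum>k<n. \<iota> k \<cdot> \<pi> k) \<cdot> f"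
      using sum id_left[OF so d f(1)] by simp
    also have "\<dots> = (\<Sum>k<n. (\<iota> k \<cdot> \<pi> k) \<cdot> f)"
      using ip by (intro comp_sum_left[OF so d d f(1)]) simp
    also have "\<dots> = (\<Sum>k<n. 0)"
    proof (rule sum.cong)
      fix k assume "k \<in> {..<n}"
      then show "(\<iota> k \<cdot> \<pi> k) \<cdot> f = 0"
        using comp_assoc[OF so d simple_ob[OF t] d f(1) p i, of k] *
          comp_zero_right[OF so simple_ob[OF t] d i, of k] by simp
    qed simp
    finally show False using f by simp
  qed
  then obtain k where k: "k < n" "\<pi> k \<cdot> f \<noteq> 0" by blast
  note tk = simple_ob[OF t[OF k(1)]]
  have "\<pi> k \<cdot> f \<in> Hom C s (t k)"
    by (rule comp_hom[OF so d tk f(1) p[OF k(1)]])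
  then obtain h where h: "h \<in> Hom C (t k) s" "h \<cdot> \<pi> k \<cdot> f = id s"
    using schur_iso[OF s t[OF k(1)]] k(2) by (auto simp: iso_mor_def inverse_mor_def)
  show thesis
  proof (rule that)
    show "h \<cdot> \<pi> k \<in> Hom C d s"
      by (rule comp_hom[OF d tk so p[OF k(1)] h(1)])
    show "(h \<cdot> \<pi> k) \<cdot> f = id s"
      using comp_assoc[OF so d tk so f(1) p[OF k(1)] h(1)] h(2) by simp
  qed
qed

text \<open>Some summand of \<open>c\<close> is not killed by \<open>u\<close>, and the restriction
  of \<open>u\<close> to it has a retraction. Tests for \<open>u = 0\<close> thereby reduce to
  identities of simple objects.\<close>

lemma nonzero_mor_split:
  assumes ob: "c \<in> Ob C" "d \<in> Ob C" and u: "u \<in> Hom C c d" "u \<noteq> 0"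
  obtains s i w where "simple_object C s" "i \<in> Hom C s c" "w \<in> Hom C d s" "w \<cdot> u \<cdot> i = id s"
proof -
  obtain n :: nat and s \<iota> \<pi> where s: "\<And>k. k < n \<Longrightarrow> simple_object C (s k)"
    and i: "\<And>k. k < n \<Longrightarrow> \<iota> k \<in> Hom C (s k) c" and p: "\<And>k. k < n \<Longrightarrow> \<pi> k \<in> Hom C c (s k)"
    and sum: "(\<Sum>k<n. \<iota> k \<cdot> \<pi> k) = id c"
    by (rule semisimple_decomposition[OF ob(1)]) blast
  have "\<exists>k<n. u \<cdot> \<iota> k \<noteq> 0"
  proof (rule ccontr)
    assume *: "\<not> (\<exists>k<n. u \<cdot> \<iota> k \<noteq> 0)"
    have ip: "\<iota> k \<cdot> \<pi> k \<in> Hom C c c" if "k < n" for k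
      using comp_hom[OF ob(1) simple_ob[OF s] ob(1) p i] that by blast
    have "u = u \<cdot> (\<Sum>k<n. \<iota> k \<cdot> \<pi> k)"
      using sum id_right[OF ob u(1)] by simp
    also have "\<dots> = (\<Sum>k<n. u \<cdot> (\<iota> k \<cdot> \<pi> k))"
      using ip by (intro comp_sum_right[OF ob(1) ob u(1)]) simp
    also have "\<dots> = (\<Sum>k<n. 0)"
    proof (rule sum.cong)
      fix k assume "k \<in> {..<n}"
      then show "u \<cdot> \<iota> k \<cdot> \<pi> k = 0"
        using comp_assoc[OF ob(1) simple_ob[OF s] ob p i u(1), of k] *
          comp_zero_left[OF ob(1) simple_ob[OF s] ob(2) p, of k] by simp
    qed simp
    finally show False using u by simp
  qed
  then obtain k where k: "k < n" "u \<cdot> \<iota> k \<noteq> 0" by blast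
  note sk = simple_ob[OF s[OF k(1)]]
  have "u \<cdot> \<iota> k \<in> Hom C (s k) d"
    by (rule comp_hom[OF sk ob i[OF k(1)] u(1)])
  then obtain w where w: "w \<in> Hom C d (s k)" "w \<cdot> u \<cdot> \<iota> k = id (s k)"
    using simple_split_mono[OF s[OF k(1)] ob(2)] k(2) by metis
  show thesis
    by (rule that[OF s[OF k(1)] i[OF k(1)] w])
qed

end

context strict_monoidal_category
begin

lemma tensor_zero_left:
  assumes "x \<in> Ob C" "y \<in> Ob C" "z \<in> Ob C" "w \<in> Ob C" "g \<in> Hom C z w"
  shows "0 \<boxtimes> g = 0"
  using tensor_add_left[OF assms(1-4) hom_zero hom_zero assms(5)] assms by simp

lemma tensor_zero_right:
  assumes "x \<in> Ob C" "y \<in> Ob C" "z \<in> Ob C" "w \<in> Ob C" "f \<in> Hom C x y"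
  shows "f \<boxtimes> 0 = 0"
  using tensor_add_right[OF assms hom_zero hom_zero] assms by simp

end

context strict_rigid_category
begin

text \<open>Each zigzag equation contains \<open>coev p\<close> as a factor. The second conclusion
  serves for \<open>p = ld s\<close>, whose right dual is \<open>s\<close>.\<close>

lemma coev_zero:
  assumes p: "p \<in> Ob C" and 0: "coev p = 0"
  shows "id p = 0" "id (rd p) = 0"
proof -
  note ob = p rdual_ob[OF p] unit_ob tensor_ob[OF p tensor_ob[OF rdual_ob[OF p] p]]
    tensor_ob[OF tensor_ob[OF rdual_ob[OF p] p] rdual_ob[OF p]]
  have "id p \<boxtimes> ev p \<in> Hom C (p \<otimes> rd p \<otimes> p) p" "ev p \<boxtimes> id (rd p) \<in> Hom C ((rd p \<otimes> p) \<otimes> rd p) (rd p)"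
    using tensor_hom[OF p p tensor_ob[OF ob(2) p] unit_ob id_hom[OF p] ev_hom[OF p]]
      tensor_hom[OF tensor_ob[OF ob(2) p] unit_ob ob(2) ob(2) ev_hom[OF p] id_hom[OF ob(2)]] ob
    by simp_all
  moreover have "0 \<boxtimes> id p = 0" "id (rd p) \<boxtimes> 0 = 0"
    using tensor_zero_left[OF ob(3) p p p id_hom[OF p]] tensor_zero_right[OF ob(2,2,3) p id_hom[OF ob(2)]]
    by simp_all
  ultimately show "id p = 0" "id (rd p) = 0"
    using rdual_zigzag[OF p] comp_zero_right[OF ob(1,4,1)] comp_zero_right[OF ob(2,5,2)]
    by (simp_all add: 0)
qed

end

section \<open>Nondegeneracy of the traces\<close>

context pivotal_category
begin

abbreviation lt :: "'a \<Rightarrow> 'b \<Rightarrow> 'b" where "lt \<equiv> left_trace C a"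
abbreviation rt :: "'a \<Rightarrow> 'b \<Rightarrow> 'b" where "rt \<equiv> right_trace C a"

lemma trace_cyclic:
  assumes "c \<in> Ob C" "d \<in> Ob C" "f \<in> Hom C c d" "g \<in> Hom C d c"
  shows "lt d (f \<cdot> g) = lt c (g \<cdot> f)" "rt d (f \<cdot> g) = rt c (g \<cdot> f)"
  using assms TL_cyclic[of "Arrow c f d" "Arrow d g c"] TR_cyclic[of "Arrow c f d" "Arrow d g c"]
  by (simp_all add: left_trace_eq right_trace_eq acomp_def)

lemma trace_add:
  assumes c: "c \<in> Ob C" and f: "f \<in> Hom C c c" and g: "g \<in> Hom C c c"
  shows "lt c (f + g) = lt c f + lt c g" "rt c (f + g) = rt c f + rt c g"
proof -
  let ?l = "ld c" and ?r = "rd c"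
  note ob = c dual_ob(1)[OF c] dual_ob(2)[OF c] dual_ob(1)[OF dual_ob(1)[OF c]] unit_ob
    tensor_ob[OF dual_ob(2)[OF c] c] tensor_ob[OF dual_ob(1)[OF c] c] tensor_ob[OF c dual_ob(1)[OF c]]
    tensor_ob[OF dual_ob(1)[OF dual_ob(1)[OF c]] dual_ob(1)[OF c]]
  have al: "a ?l \<in> Hom C ?l ?r" using a_hom[OF ob(3)] c by simp
  note t = tensor_hom[OF ob(3,2) c c al]
  have k: "coev' c \<in> Hom C \<one> (?l \<otimes> c)" by (rule coev'_hom[OF c])
  note h = comp_hom[OF ob(5,6,7) k]
  show "lt c (f + g) = lt c f + lt c g"
    unfolding left_trace_def tensor_add_right[OF ob(3,2) c c al f g]
      comp_add_left[OF ob(5,6,7) k t[OF f] t[OF g]]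
    by (rule comp_add_right[OF ob(5,7,5) h[OF t[OF f]] h[OF t[OF g]] ev_hom[OF c]])
  have ac: "a c \<in> Hom C c (rd ?r)" by (rule a_hom[OF c])
  note afh = comp_hom[OF c c ob(4) _ ac]
  note t = tensor_hom[OF c ob(4) ob(2) ob(2) _ id_hom[OF ob(2)]]
  note h = comp_hom[OF ob(5,8,9) coev_hom[OF c]]
  show "rt c (f + g) = rt c f + rt c g"
    unfolding right_trace_def comp_add_right[OF c c ob(4) f g ac]
      tensor_add_left[OF c ob(4) ob(2) ob(2) afh[OF f] afh[OF g] id_hom[OF ob(2)]]
      comp_add_left[OF ob(5,8,9) coev_hom[OF c] t[OF afh[OF f]] t[OF afh[OF g]]]
    by (rule comp_add_right[OF ob(5,9,5) h[OF t[OF afh[OF f]]] h[OF t[OF afh[OF g]]] ev_hom[OF ob(2)]])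
qed

lemma trace_scale:
  assumes c: "c \<in> Ob C" and f: "f \<in> Hom C c c"
  shows "lt c (Scale C z f) = Scale C z (lt c f)" "rt c (Scale C z f) = Scale C z (rt c f)"
proof -
  let ?l = "ld c" and ?r = "rd c"
  note ob = c dual_ob(1)[OF c] dual_ob(2)[OF c] dual_ob(1)[OF dual_ob(1)[OF c]] unit_ob
    tensor_ob[OF dual_ob(2)[OF c] c] tensor_ob[OF dual_ob(1)[OF c] c] tensor_ob[OF c dual_ob(1)[OF c]]
    tensor_ob[OF dual_ob(1)[OF dual_ob(1)[OF c]] dual_ob(1)[OF c]]
  have al: "a ?l \<in> Hom C ?l ?r" using a_hom[OF ob(3)] c by simp
  note t = tensor_hom[OF ob(3,2) c c al f]
  have k: "coev' c \<in> Hom C \<one> (?l \<otimes> c)" by (rule coev'_hom[OF c])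
  show "lt c (Scale C z f) = Scale C z (lt c f)"
    unfolding left_trace_def tensor_scale_right[OF ob(3,2) c c al f] comp_scale_left[OF ob(5,6,7) k t]
    by (rule comp_scale_right[OF ob(5,7,5) comp_hom[OF ob(5,6,7) k t] ev_hom[OF c]])
  note af = comp_hom[OF c c ob(4) f a_hom[OF c]]
  note t = tensor_hom[OF c ob(4) ob(2) ob(2) af id_hom[OF ob(2)]]
  show "rt c (Scale C z f) = Scale C z (rt c f)"
    unfolding right_trace_def comp_scale_right[OF c c ob(4) f a_hom[OF c]]
      tensor_scale_left[OF c ob(4) ob(2) ob(2) af id_hom[OF ob(2)]]
      comp_scale_left[OF ob(5,8,9) coev_hom[OF c] t]
    by (rule comp_scale_right[OF ob(5,9,5) comp_hom[OF ob(5,8,9) coev_hom[OF c] t] ev_hom[OF ob(2)]])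
qed

lemma trace_zero:
  assumes "c \<in> Ob C"
  shows "lt c 0 = 0" "rt c 0 = 0"
  using trace_add[OF assms hom_zero hom_zero] assms by simp_all

lemma trace_diff:
  assumes "c \<in> Ob C" "f \<in> Hom C c c" "g \<in> Hom C c c"
  shows "lt c (f - g) = lt c f - lt c g" "rt c (f - g) = rt c f - rt c g"
  using trace_add[OF assms(1) hom_diff[OF assms(1,1,2,3)] assms(3)] by simp_all

lemma trace_sum:
  assumes c: "c \<in> Ob C" and f: "\<And>k. k \<in> S \<Longrightarrow> f k \<in> Hom C c c"
  shows "lt c (sum f S) = (\<Sum>k\<in>S. lt c (f k))" "rt c (sum f S) = (\<Sum>k\<in>S. rt c (f k))"
  using f
  by (induction S rule: infinite_finite_induct)
    (simp_all add: trace_zero[OF c] trace_add[OF c] hom_sum[OF c c])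

lemma lt_dual:
  assumes "p \<in> Ob C" "v \<in> Hom C p p"
  shows "lt (rd p) (dual_mor C p p v) = rt p v"
  using assms TL_dual[of "Arrow p v p"] by (simp add: left_trace_eq right_trace_eq dual_def)

lemma dual_mor_hom: "\<lbrakk>x \<in> Ob C; y \<in> Ob C; f \<in> Hom C x y\<rbrakk> \<Longrightarrow> dual_mor C x y f \<in> Hom C (rd y) (rd x)"
  using arr_dual[of "Arrow x f y"] by (simp add: dual_def arr_def)

end

locale pivotal_fusion_category = fusion_category C + pivotal_category C a
  for C :: "('a, 'b::ab_group_add) tensor_data" (structure) and a
begin

interpretation vs: vector_space "Scale C"
  by (rule scale_vector_space)

text \<open>The unit is simple, so a nonzero \<open>coev\<close> has a left inverse; it is a right trace.\<close>

lemma right_trace_one: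
  assumes [simp]: "p \<in> Ob C" and "coev p \<noteq> 0"
  obtains v where "v \<in> Hom C p p" "rt p v = id \<one>"
proof -
  obtain g where g: "g \<in> Hom C (p \<otimes> rd p) \<one>" "g \<cdot> coev p = id \<one>"
    using simple_split_mono[OF unit_simple _ coev_hom[OF assms(1)] assms(2)] assms(1) by auto
  define G where "G = Arrow (p \<otimes> rd p) g \<one>"
  have [simp]: "arr G" "src G = p \<otimes> rd p" "trg G = \<one>" and GK: "G \<bullet> K p = I \<one>"
    using g by (auto simp: G_def intro!: arrow.expand)
  obtain B where [simp]: "arr B" "src B = rd (rd p)" "trg B = p"
    and B: "B \<bullet> A p = I p" "A p \<bullet> B = I (rd (rd p))"
    by (rule A_inverse[of p]) simp_all
  \<comment> \<open>\<open>w\<close> is the morphism from \<open>p\<close> to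
    \<open>rd (rd p)\<close> whose evaluation is \<open>G\<close>. The inverse pivotal morphism
    \<open>B\<close> makes it an endomorphism of \<open>p\<close>, with right trace
    \<open>G \<bullet> K p\<close>.\<close>
  define w where "w = comparison p G (rd (rd p)) (K (rd p))"
  have [simp]: "arr w" "src w = p" "trg w = rd (rd p)"
    unfolding w_def by (rule arr_comparison[where c = "rd p"]) simp_all
  have 1: "E (rd p) \<bullet> (w \<odot> I (rd p)) = G"
    unfolding w_def by (rule ev_comparison_dual_pair[OF dual_pair_rd]) simp_all
  have "TR (B \<bullet> w) = E (rd p) \<bullet> (((A p \<bullet> B) \<bullet> w) \<odot> I (rd p)) \<bullet> K p"
    by (simp add: TR_def)
  also have "\<dots> = I \<one>"
    unfolding B by (simp add: comp_reduce1[OF 1] GK)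
  finally have "rt p (mor (B \<bullet> w)) = id \<one>"
    by (simp add: right_trace_eq acomp_def I_def)
  moreover have "mor (B \<bullet> w) \<in> Hom C p p"
    by (rule arr_in_hom) simp_all
  ultimately show thesis
    using that by blast
qed

lemma simple_coev_nonzero:
  assumes "simple_object C s"
  shows "coev s \<noteq> 0" "coev (ld s) \<noteq> 0"
  using coev_zero[of s] coev_zero[of "ld s"] simple_id_nonzero[OF assms] simple_ob[OF assms] by auto

text \<open>If \<open>u\<close> is nonzero, some \<open>w \<cdot> u \<cdot> i\<close> is the
  identity of a simple object \<open>s\<close>. Inserting an endomorphism \<open>v\<close> of
  \<open>s\<close> with trace one, cyclicity turns the trace of
  \<open>(i \<cdot> v \<cdot> w) \<cdot> u\<close> into that of \<open>v\<close>.\<close>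

lemma right_trace_nondegenerate:
  assumes ob: "c \<in> Ob C" "d \<in> Ob C" and u: "u \<in> Hom C c d"
    and 0: "\<And>v. v \<in> Hom C d c \<Longrightarrow> rt c (v \<cdot> u) = 0"
  shows "u = 0"
proof (rule ccontr)
  assume "u \<noteq> 0"
  then obtain s i w where s: "simple_object C s" and i: "i \<in> Hom C s c" and w: "w \<in> Hom C d s"
    and wui: "w \<cdot> u \<cdot> i = id s"
    using nonzero_mor_split[OF ob u] by metis
  note so = simple_ob[OF s]
  obtain v where v: "v \<in> Hom C s s" "rt s v = id \<one>"
    using right_trace_one[OF so simple_coev_nonzero(1)[OF s]] .
  note vw = comp_hom[OF ob(2) so so w v(1)] and ui = comp_hom[OF so ob i u]
  have vwu: "(v \<cdot> w) \<cdot> u \<in> Hom C c s" by (rule comp_hom[OF ob so u vw])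
  have "rt c ((i \<cdot> (v \<cdot> w)) \<cdot> u) = rt c (i \<cdot> ((v \<cdot> w) \<cdot> u))"
    using comp_assoc[OF ob so ob(1) u vw i] by simp
  also have "\<dots> = rt s (((v \<cdot> w) \<cdot> u) \<cdot> i)"
    by (rule trace_cyclic(2)[OF so ob(1) i vwu])
  also have "((v \<cdot> w) \<cdot> u) \<cdot> i = v"
    using comp_assoc[OF so ob so i u vw] comp_assoc[OF so ob(2) so so ui w v(1)] wui
      id_right[OF so so v(1)] by simp
  finally have "id \<one> = 0"
    using 0[OF comp_hom[OF ob(2) so ob(1) vw i]] v(2) by simp
  then show False
    using simple_id_nonzero[OF unit_simple] by simp
qed

lemma right_trace_eqI:
  assumes ob: "c \<in> Ob C" "d \<in> Ob C" and u: "u \<in> Hom C c d" "u' \<in> Hom C c d"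
    and eq: "\<And>v. v \<in> Hom C d c \<Longrightarrow> rt c (v \<cdot> u) = rt c (v \<cdot> u')"
  shows "u = u'"
proof -
  have "u - u' = 0"
  proof (rule right_trace_nondegenerate[OF ob hom_diff[OF ob u]])
    fix v assume v: "v \<in> Hom C d c"
    then show "rt c (v \<cdot> (u - u')) = 0"
      using eq[OF v] comp_diff_right[OF ob ob(1) u v] trace_diff(2)[OF ob(1) comp_hom[OF ob ob(1) u(1) v]
        comp_hom[OF ob ob(1) u(2) v]] by simp
  qed
  then show ?thesis by simp
qed

text \<open>An endomorphism of trace one is a scalar multiple of the identity, so the trace of the
  identity is the inverse scalar. Stated for any homogeneous \<open>t\<close>, it covers both
  traces.\<close>

lemma scalar_eq_of_trace_one:
  assumes s: "simple_object C s" and v: "v \<in> Hom C s s"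
    and t: "\<And>z f. f \<in> Hom C s s \<Longrightarrow> t (Scale C z f) = Scale C z (t f)" "t v = id \<one>"
  obtains r where "r \<noteq> 0" "t (id s) = Scale C r (id \<one>)"
proof -
  note so = simple_ob[OF s]
  obtain z where z: "v = Scale C z (id s)" using schur_scalar[OF s v] .
  then have e: "Scale C z (t (id s)) = id \<one>"
    using t id_hom[OF so] by metis
  then have "z \<noteq> 0"
    using simple_id_nonzero[OF unit_simple] by auto
  then have "t (id s) = Scale C (1 / z) (Scale C z (t (id s)))"
    by simp
  then show thesis
    using that[of "1 / z"] \<open>z \<noteq> 0\<close> e by simp
qed

text \<open>The factor is the left dimension divided by the right dimension, and both traces of a
  scalar are multiples of these. The work lies in showing that neither dimension vanishes.\<close>

lemma simple_trace_ratio: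
  assumes s: "simple_object C s"
  obtains z where "z \<noteq> 0" "\<And>v. v \<in> Hom C s s \<Longrightarrow> lt s v = Scale C z (rt s v)"
proof -
  note so = simple_ob[OF s]
  obtain v where v: "v \<in> Hom C s s" "rt s v = id \<one>"
    using right_trace_one[OF so simple_coev_nonzero(1)[OF s]] .
  obtain v' where v': "v' \<in> Hom C (ld s) (ld s)" "rt (ld s) v' = id \<one>"
    using right_trace_one[OF dual_ob(2)[OF so] simple_coev_nonzero(2)[OF s]] .
  \<comment> \<open>Transposing an endomorphism of \<open>ld s\<close> with right trace one gives an
    endomorphism of \<open>s\<close> with left trace one.\<close>
  have w: "dual_mor C (ld s) (ld s) v' \<in> Hom C s s" "lt s (dual_mor C (ld s) (ld s) v') = id \<one>"
    using dual_mor_hom[OF dual_ob(2)[OF so] dual_ob(2)[OF so] v'(1)]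
      lt_dual[OF dual_ob(2)[OF so] v'(1)] v'(2) so by simp_all
  obtain r where r: "r \<noteq> 0" "rt s (id s) = Scale C r (id \<one>)"
    using scalar_eq_of_trace_one[OF s v(1) trace_scale(2)[OF so] v(2)] .
  obtain l where l: "l \<noteq> 0" "lt s (id s) = Scale C l (id \<one>)"
    using scalar_eq_of_trace_one[OF s w(1) trace_scale(1)[OF so] w(2)] .
  show thesis
  proof (rule that[of "l / r"])
    fix v assume "v \<in> Hom C s s"
    then obtain z where "v = Scale C z (id s)" using schur_scalar[OF s] by metis
    then show "lt s v = Scale C (l / r) (rt s v)"
      using r l trace_scale[OF so id_hom[OF so]] by (simp add: mult.commute)
  qed (use r l in simp)
qed

text \<open>On a simple object the two traces are proportional; a semisimple decomposition transports
  the factors to any object.\<close>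

lemma trace_comparison:
  assumes c: "c \<in> Ob C"
  obtains l m where "l \<in> Hom C c c" "m \<in> Hom C c c"
    "\<And>v. v \<in> Hom C c c \<Longrightarrow> lt c v = rt c (v \<cdot> l)"
    "\<And>v. v \<in> Hom C c c \<Longrightarrow> rt c v = lt c (v \<cdot> m)"
proof -
  obtain n :: nat and s \<iota> \<pi> where s: "\<And>k. k < n \<Longrightarrow> simple_object C (s k)"
    and i: "\<And>k. k < n \<Longrightarrow> \<iota> k \<in> Hom C (s k) c" and p: "\<And>k. k < n \<Longrightarrow> \<pi> k \<in> Hom C c (s k)"
    and sum: "(\<Sum>k<n. \<iota> k \<cdot> \<pi> k) = id c"
    by (rule semisimple_decomposition[OF c]) blast
  note so = simple_ob[OF s]
  have "\<exists>z. z \<noteq> 0 \<and> (\<forall>v\<in>Hom C (s k) (s k). lt (s k) v = Scale C z (rt (s k) v))" if "k < n" for k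
    using simple_trace_ratio[OF s[OF that]] by metis
  then obtain z where z: "\<And>k. k < n \<Longrightarrow> z k \<noteq> 0"
    "\<And>k v. \<lbrakk>k < n; v \<in> Hom C (s k) (s k)\<rbrakk> \<Longrightarrow> lt (s k) v = Scale C (z k) (rt (s k) v)"
    by metis
  define e where "e k = \<iota> k \<cdot> \<pi> k" for k
  have e: "e k \<in> Hom C c c" if "k < n" for k
    unfolding e_def by (rule comp_hom[OF c so[OF that] c p[OF that] i[OF that]])
  \<comment> \<open>By cyclicity the trace of \<open>v \<cdot> e k\<close> is that of an
    endomorphism of the simple object \<open>s k\<close>, where the ratio is known.\<close>
  have ratio: "lt c (v \<cdot> e k) = Scale C (z k) (rt c (v \<cdot> e k))" if "k < n" "v \<in> Hom C c c" for k v
  proof -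
    note k = so[OF that(1)] p[OF that(1)] i[OF that(1)]
    have "v \<cdot> e k = (v \<cdot> \<iota> k) \<cdot> \<pi> k"
      unfolding e_def using comp_assoc[OF c k(1) c c k(2,3) that(2)] by simp
    moreover have "v \<cdot> \<iota> k \<in> Hom C (s k) c" by (rule comp_hom[OF k(1) c c k(3) that(2)])
    ultimately show ?thesis
      using trace_cyclic[OF k(1) c _ k(2), of "v \<cdot> \<iota> k"] z(2)[OF that(1)]
        comp_hom[OF k(1) c k(1) _ k(2), of "v \<cdot> \<iota> k"] by simp
  qed
  have vsum: "v \<cdot> (\<Sum>k<n. Scale C (y k) (e k)) = (\<Sum>k<n. Scale C (y k) (v \<cdot> e k))"
    if "v \<in> Hom C c c" for v y
    using e hom_scale[OF c c] comp_scale_right[OF c c c _ that]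
    by (subst comp_sum_right[OF c c c that]) auto
  have ve: "v \<cdot> e k \<in> Hom C c c" if "k < n" "v \<in> Hom C c c" for v k
    by (rule comp_hom[OF c c c e[OF that(1)] that(2)])
  have v1: "v = (\<Sum>k<n. v \<cdot> e k)" if "v \<in> Hom C c c" for v
    using vsum[OF that, of "\<lambda>_. 1"] id_right[OF c c that] sum by (simp add: e_def)
  show thesis
  \<comment> \<open>\<open>l\<close> and \<open>m\<close> weight the summands \<open>e k\<close> by
    the ratios \<open>z k\<close> and by their inverses.\<close>
  proof (rule that)
    fix v assume v: "v \<in> Hom C c c"
    have L: "lt c v = (\<Sum>k<n. lt c (v \<cdot> e k))" and R: "rt c v = (\<Sum>k<n. rt c (v \<cdot> e k))"
      using trace_sum[OF c, of "{..<n}" "\<lambda>k. v \<cdot> e k"] ve[OF _ v] v1[OF v] by simp_all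
    have "lt c v = (\<Sum>k<n. rt c (Scale C (z k) (v \<cdot> e k)))"
      unfolding L using trace_scale(2)[OF c ve[OF _ v]] ratio[OF _ v] by simp
    also have "\<dots> = rt c (v \<cdot> (\<Sum>k<n. Scale C (z k) (e k)))"
      unfolding vsum[OF v] using hom_scale[OF c c] ve[OF _ v] by (intro trace_sum(2)[OF c, symmetric]) simp
    finally show "lt c v = rt c (v \<cdot> (\<Sum>k<n. Scale C (z k) (e k)))" .
    have "rt c v = (\<Sum>k<n. lt c (Scale C (1 / z k) (v \<cdot> e k)))"
      unfolding R using trace_scale(1)[OF c ve[OF _ v]] ratio[OF _ v] z(1) by simp
    also have "\<dots> = lt c (v \<cdot> (\<Sum>k<n. Scale C (1 / z k) (e k)))"
      unfolding vsum[OF v] using hom_scale[OF c c] ve[OF _ v] by (intro trace_sum(1)[OF c, symmetric]) simp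
    finally show "rt c v = lt c (v \<cdot> (\<Sum>k<n. Scale C (1 / z k) (e k)))" .
  qed (use e in \<open>auto intro!: hom_sum hom_scale c\<close>)
qed

text \<open>The conversion \<open>m\<close> expresses right traces through left ones, and cyclicity
  moves it into the test morphism; nondegeneracy is thus inherited from the right trace.\<close>

lemma left_trace_eqI:
  assumes ob: "c \<in> Ob C" "d \<in> Ob C" and u: "u \<in> Hom C c d" "u' \<in> Hom C c d"
    and eq: "\<And>v. v \<in> Hom C d c \<Longrightarrow> lt c (v \<cdot> u) = lt c (v \<cdot> u')"
  shows "u = u'"
proof (rule right_trace_eqI[OF ob u])
  fix v assume v: "v \<in> Hom C d c"
  obtain l m where m: "m \<in> Hom C c c" "\<And>v. v \<in> Hom C c c \<Longrightarrow> rt c v = lt c (v \<cdot> m)"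
    using trace_comparison[OF ob(1)] by metis
  have "rt c (v \<cdot> w) = lt c ((m \<cdot> v) \<cdot> w)" if w: "w \<in> Hom C c d" for w
    using m(2)[OF comp_hom[OF ob ob(1) w v]] trace_cyclic(1)[OF ob(1) ob(1) comp_hom[OF ob ob(1) w v] m(1)]
      comp_assoc[OF ob ob(1) ob(1) w v m(1)] by simp
  then show "rt c (v \<cdot> u) = rt c (v \<cdot> u')"
    using u eq[OF comp_hom[OF ob(2) ob(1) ob(1) v m(1)]] by simp
qed

text \<open>Multiplicativity on \<open>\<one> \<otimes> \<one> = \<one>\<close> shows that composing
  \<open>v\<close> with \<open>TL (I \<one>)\<close> leaves its left trace unchanged, and
  nondegeneracy makes that factor the identity.\<close>

lemma TL_I_unit: "TL (I \<one>) = I \<one>"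
proof -
  have "lt \<one> (v \<cdot> mor (TL (I \<one>))) = lt \<one> (v \<cdot> id \<one>)" if v: "v \<in> Hom C \<one> \<one>" for v
  proof -
    let ?V = "Arrow \<one> v \<one>"
    have "TL ?V = TL (PL \<one> \<one> \<one> ?V)"
      using TL_tensor[of \<one> \<one> ?V] v by simp
    also have "PL \<one> \<one> \<one> ?V = ?V \<bullet> PL \<one> \<one> \<one> (I \<one>)"
      using PL_natural[of \<one> ?V "I \<one>" "I \<one>" \<one> \<one> \<one> \<one>] v by simp
    also have "PL \<one> \<one> \<one> (I \<one>) = TL (I \<one>)"
      by (simp add: PL_def TL_def)
    finally show ?thesis
      using id_right[OF unit_ob unit_ob v] by (simp add: left_trace_eq acomp_def)
  qed
  note eq = this
  have "mor (TL (I \<one>)) \<in> Hom C \<one> \<one>"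
    by (rule arr_in_hom) simp_all
  then have "mor (TL (I \<one>)) = id \<one>"
    by (rule left_trace_eqI[OF unit_ob unit_ob _ id_hom[OF unit_ob] eq])
  then show ?thesis
    by (intro arrow.expand) simp
qed

lemma PL_unit:
  assumes [simp]: "arr h" "src h = x" "trg h = y"
  shows "PL \<one> x y h = h"
proof -
  have [simp]: "x \<in> Ob C" "y \<in> Ob C"
    using arr_ob[OF assms(1)] by simp_all
  have "PL \<one> x y h = h \<bullet> PL \<one> x x (I x)"
    using PL_natural[of \<one> h "I x" "I x" x x x y] by simp
  also have "PL \<one> x x (I x) = TL (I \<one>) \<odot> I x"
    by (simp add: PL_def TL_def whisker)
  finally show ?thesis
    by (simp add: TL_I_unit)
qed

text \<open>This allows the outer trace in the conjugate condition to be dropped when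
  \<open>d\<close> is the unit.\<close>

lemma TL_unit:
  assumes "arr w" "src w = \<one>" "trg w = \<one>"
  shows "TL w = w"
  using PL_unit[OF assms] assms by (simp add: PL_def TL_def)

text \<open>The right side is the case where \<open>d\<close> is the unit and \<open>f\<close> the
  identity of \<open>x\<close>. It implies the general case: cyclicity and multiplicativity replace
  \<open>f \<cdot> g\<close> by its partial trace over \<open>d\<close>, which is a morphism from
  \<open>ld (ld x)\<close> to \<open>x\<close>.\<close>

lemma conjugate_condition_iff:
  assumes [simp]: "x \<in> Ob C" and t: "t \<in> Hom C x (ld (ld x))"
  shows "conjugate_condition C a x t \<longleftrightarrow>
    (\<forall>u\<in>Hom C (ld (ld x)) x. lt x (u \<cdot> t) = ev' x \<cdot> (u \<boxtimes> id (ld x)) \<cdot> coev' (ld x))"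
    (is "_ \<longleftrightarrow> (\<forall>u\<in>_. ?P u)")
proof
  let ?z = "ld (ld x)"
  define T where "T = Arrow x t ?z"
  define e where "e = Arrow (x \<otimes> ld x) (ev' x) \<one>"
  define k where "k = Arrow \<one> (coev' (ld x)) (?z \<otimes> ld x)"
  have [simp]: "arr T" "src T = x" "trg T = ?z" "mor T = t"
    "arr e" "src e = x \<otimes> ld x" "trg e = \<one>" "mor e = ev' x"
    "arr k" "src k = \<one>" "trg k = ?z \<otimes> ld x" "mor k = coev' (ld x)"
    using t by (simp_all add: T_def e_def k_def ev'_hom coev'_hom)
  { assume cond: "conjugate_condition C a x t"
    show "\<forall>u\<in>Hom C ?z x. ?P u"
    proof
      fix u assume u: "u \<in> Hom C ?z x"
      define U where "U = Arrow ?z u x"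
      have [simp]: "arr U" "src U = ?z" "trg U = x" "mor U = u"
        using u by (simp_all add: U_def)
      have "lt x (mor (U \<bullet> (I \<one> \<odot> T) \<bullet> I x))
          = lt \<one> (mor ((I \<one> \<odot> e) \<bullet> ((I x \<bullet> U) \<odot> I (ld x)) \<bullet> (I \<one> \<odot> k)))"
        using cond[unfolded conjugate_condition_def, rule_format, of x \<one> "id x" u] u
        by (simp del: comp_I_left comp_I_right tensor_I_unit add: id_hom)
      then have "lt x (u \<cdot> t) = lt \<one> (mor (e \<bullet> (U \<odot> I (ld x)) \<bullet> k))"
        by simp
      also have "\<dots> = mor (TL (e \<bullet> (U \<odot> I (ld x)) \<bullet> k))"
        by (simp add: left_trace_eq acomp_def)
      also have "TL (e \<bullet> (U \<odot> I (ld x)) \<bullet> k) = e \<bullet> (U \<odot> I (ld x)) \<bullet> k"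
        by (rule TL_unit) simp_all
      finally show "?P u" by simp
    qed
  next
    assume P: "\<forall>u\<in>Hom C ?z x. ?P u"
    show "conjugate_condition C a x t"
      unfolding conjugate_condition_def
    proof (intro ballI)
      fix c d f g
      assume [simp]: "c \<in> Ob C" "d \<in> Ob C" and f: "f \<in> Hom C c (d \<otimes> x)" and g: "g \<in> Hom C (d \<otimes> ?z) c"
      define F where "F = Arrow c f (d \<otimes> x)"
      define G where "G = Arrow (d \<otimes> ?z) g c"
      have [simp]: "arr F" "src F = c" "trg F = d \<otimes> x" "mor F = f"
        "arr G" "src G = d \<otimes> ?z" "trg G = c" "mor G = g"
        using f g by (simp_all add: F_def G_def)
      define U where "U = PL d ?z x (F \<bullet> G)"
      have [simp]: "arr U" "src U = ?z" "trg U = x" by (simp_all add: U_def)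
      have "TL (G \<bullet> (I d \<odot> T) \<bullet> F) = TL ((G \<bullet> (I d \<odot> T)) \<bullet> F)" by simp
      also have "\<dots> = TL (F \<bullet> G \<bullet> (I d \<odot> T))"
        by (rule TL_cyclic) simp_all
      also have "\<dots> = TL (PL d x x (F \<bullet> G \<bullet> (I d \<odot> T)))"
        by (rule TL_tensor) simp_all
      also have "PL d x x (F \<bullet> G \<bullet> (I d \<odot> T)) = U \<bullet> T"
        using PL_natural[of d "I x" T "F \<bullet> G" ?z x x x] by (simp add: U_def)
      also have "TL (U \<bullet> T) = e \<bullet> (U \<odot> I (ld x)) \<bullet> k"
        using P[rule_format, OF arr_in_hom[of U]] by (intro arrow.expand) (simp add: left_trace_eq acomp_def)
      also have "\<dots> = TL ((I d \<odot> e) \<bullet> ((F \<bullet> G) \<odot> I (ld x)) \<bullet> (I d \<odot> k))"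
        unfolding U_def by (rule TL_close_right[symmetric]) simp_all
      finally show "lt c (g \<cdot> (id d \<boxtimes> t) \<cdot> f)
          = lt d ((id d \<boxtimes> ev' x) \<cdot> ((f \<cdot> g) \<boxtimes> id (ld x)) \<cdot> (id d \<boxtimes> coev' (ld x)))"
        by (simp add: left_trace_eq acomp_def atensor_def I_def)
    qed }
qed

text \<open>By the reduced form of the condition, all left traces of \<open>u \<cdot> t\<close> are
  prescribed, so nondegeneracy determines \<open>t\<close>.\<close>

lemma conjugate_condition_unique:
  assumes x: "x \<in> Ob C" and t: "t \<in> Hom C x (ld (ld x))" "t' \<in> Hom C x (ld (ld x))"
    and "conjugate_condition C a x t" "conjugate_condition C a x t'"
  shows "t = t'"
  using assms conjugate_condition_iff[OF x] dual_ob(2)[OF dual_ob(2)[OF x]]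
  by (intro left_trace_eqI[OF x _ t]) auto

lemma pivotal_inverse:
  assumes "pivotal_structure C b" "x \<in> Ob C"
  shows "inverse_mor C (ld (ld x)) x (b (ld (ld x))) (inv_mor C (ld (ld x)) x (b (ld (ld x))))"
  using assms by (intro inv_mor) (auto simp: pivotal_structure_def dest!: bspec[where x = "ld (ld x)"])

text \<open>Conjugation exchanges the two traces. Everything about the conjugate is read off from this.\<close>

lemma is_conjugate_iff:
  assumes b: "pivotal_structure C b"
  shows "is_conjugate C a b \<longleftrightarrow> (\<forall>c\<in>Ob C. \<forall>v\<in>Hom C c c. lt c v = right_trace C b c v)"
proof -
  have eq: "conjugate_condition C a x (inv_mor C (ld (ld x)) x (b (ld (ld x))))
      \<longleftrightarrow> (\<forall>v\<in>Hom C (ld (ld x)) (ld (ld x)). lt (ld (ld x)) v = right_trace C b (ld (ld x)) v)"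
    (is "?cond \<longleftrightarrow> ?tr") if x: "x \<in> Ob C" for x
  proof -
    define z where "z = ld (ld x)"
    have z: "z \<in> Ob C" using x by (simp add: z_def)
    define t where "t = inv_mor C z x (b z)"
    have "inverse_mor C z x (b z) t"
      unfolding t_def z_def by (rule pivotal_inverse[OF b x])
    then have bz: "b z \<in> Hom C z x" and t: "t \<in> Hom C x z" and tb: "t \<cdot> b z = id z" "b z \<cdot> t = id x"
      by (auto simp: inverse_mor_def)
    have rt: "right_trace C b z v = ev' x \<cdot> ((b z \<cdot> v) \<boxtimes> id (ld x)) \<cdot> coev' (ld x)" for v
      using x ev_ldual[of x] coev_ldual[of "ld x"] by (simp add: right_trace_def z_def)
    \<comment> \<open>Cyclicity brings \<open>t\<close> next to its inverse \<open>b z\<close>.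
      Substituting \<open>u = b z \<cdot> v\<close> then identifies the two families of
      equations.\<close>
    have lt: "lt x ((b z \<cdot> v) \<cdot> t) = lt z v" if v: "v \<in> Hom C z z" for v
    proof -
      have vt: "v \<cdot> t \<in> Hom C x z" by (rule comp_hom[OF x z z t v])
      have "lt x ((b z \<cdot> v) \<cdot> t) = lt x (b z \<cdot> (v \<cdot> t))"
        using comp_assoc[OF x z z x t v bz] by simp
      also have "\<dots> = lt z ((v \<cdot> t) \<cdot> b z)"
        by (rule trace_cyclic(1)[OF z x bz vt])
      also have "(v \<cdot> t) \<cdot> b z = v"
        using comp_assoc[OF z x z z bz t v] tb id_right[OF z z v] by simp
      finally show ?thesis .
    qed
    have "?cond \<longleftrightarrow> (\<forall>u\<in>Hom C z x. lt x (u \<cdot> t) = ev' x \<cdot> (u \<boxtimes> id (ld x)) \<cdot> coev' (ld x))"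
      using conjugate_condition_iff[OF x, of t] t unfolding t_def z_def by simp
    also have "\<dots> \<longleftrightarrow> (\<forall>v\<in>Hom C z z. lt z v = right_trace C b z v)"
    proof safe
      fix v assume *: "\<forall>u\<in>Hom C z x. lt x (u \<cdot> t) = ev' x \<cdot> (u \<boxtimes> id (ld x)) \<cdot> coev' (ld x)"
        and v: "v \<in> Hom C z z"
      show "lt z v = right_trace C b z v"
        using *[rule_format, OF comp_hom[OF z z x v bz]] lt[OF v] rt by simp
    next
      fix u assume *: "\<forall>v\<in>Hom C z z. lt z v = right_trace C b z v" and u: "u \<in> Hom C z x"
      have tu: "t \<cdot> u \<in> Hom C z z" by (rule comp_hom[OF z x z u t])
      have "b z \<cdot> t \<cdot> u = u"
        using comp_assoc[OF z x z x u t bz] tb id_left[OF z x u] by simp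
      then show "lt x (u \<cdot> t) = ev' x \<cdot> (u \<boxtimes> id (ld x)) \<cdot> coev' (ld x)"
        using *[rule_format, OF tu] lt[OF tu] rt[of "t \<cdot> u"] by simp
    qed
    finally show ?thesis by (simp add: z_def)
  qed
  show ?thesis
  proof
    assume conj: "is_conjugate C a b"
    show "\<forall>c\<in>Ob C. \<forall>v\<in>Hom C c c. lt c v = right_trace C b c v"
    proof
      \<comment> \<open>Every object is a double left dual, namely that of its double right
        dual.\<close>
      fix c assume "c \<in> Ob C"
      then show "\<forall>v\<in>Hom C c c. lt c v = right_trace C b c v"
        using conj[unfolded is_conjugate_def, THEN conjunct2, rule_format, of "rd (rd c)"]
          eq[of "rd (rd c)"] by simp
    qed
  next
    assume "\<forall>c\<in>Ob C. \<forall>v\<in>Hom C c c. lt c v = right_trace C b c v"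
    then show "is_conjugate C a b"
      using b eq by (simp add: is_conjugate_def)
  qed
qed

section \<open>Construction of the conjugate\<close>

text \<open>The choice is unique by \<open>right_trace_eqI\<close>. Since no decomposition enters
  the characterisation, properties of \<open>lam\<close> are proved by comparing traces.\<close>

definition lam :: "'a \<Rightarrow> 'b" where
  "lam c = (SOME l. l \<in> Hom C c c \<and> (\<forall>v\<in>Hom C c c. lt c v = rt c (v \<cdot> l)))"

lemma
  assumes c: "c \<in> Ob C"
  shows lam_hom: "lam c \<in> Hom C c c"
    and lt_eq_rt_lam: "v \<in> Hom C c c \<Longrightarrow> lt c v = rt c (v \<cdot> lam c)"
proof -
  have "\<exists>l. l \<in> Hom C c c \<and> (\<forall>v\<in>Hom C c c. lt c v = rt c (v \<cdot> l))"
    using trace_comparison[OF c] by metis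
  then have "lam c \<in> Hom C c c \<and> (\<forall>v\<in>Hom C c c. lt c v = rt c (v \<cdot> lam c))"
    unfolding lam_def by (rule someI_ex)
  then show "lam c \<in> Hom C c c" "v \<in> Hom C c c \<Longrightarrow> lt c v = rt c (v \<cdot> lam c)"
    by simp_all
qed

text \<open>Converting left traces to right ones and back changes no trace, so both round trips are
  identities by nondegeneracy.\<close>

lemma lam_inverse:
  assumes c: "c \<in> Ob C"
  obtains m where "inverse_mor C c c (lam c) m"
proof -
  note l = lam_hom[OF c]
  obtain m where m: "m \<in> Hom C c c" and mt: "\<And>v. v \<in> Hom C c c \<Longrightarrow> rt c v = lt c (v \<cdot> m)"
    using trace_comparison[OF c] by metis
  have comp: "g \<cdot> f \<in> Hom C c c" if "f \<in> Hom C c c" "g \<in> Hom C c c" for f g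
    by (rule comp_hom[OF c c c that])
  have assoc: "(h \<cdot> g) \<cdot> f = h \<cdot> g \<cdot> f" if "f \<in> Hom C c c" "g \<in> Hom C c c" "h \<in> Hom C c c" for f g h
    by (rule comp_assoc[OF c c c c that])
  have "m \<cdot> lam c = id c"
    by (rule right_trace_eqI[OF c c comp[OF l m] id_hom[OF c]])
      (use mt lt_eq_rt_lam[OF c] comp assoc id_right[OF c c] l m in \<open>metis (no_types)\<close>)
  moreover have "lam c \<cdot> m = id c"
    by (rule left_trace_eqI[OF c c comp[OF m l] id_hom[OF c]])
      (use mt lt_eq_rt_lam[OF c] comp assoc id_right[OF c c] l m in \<open>metis (no_types)\<close>)
  ultimately show thesis
    using that[of m] l m by (simp add: inverse_mor_def)
qed

text \<open>Both traces are cyclic, so \<open>f\<close> can be carried around with the right trace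
  on one side and with the left trace on the other.\<close>

lemma lam_natural:
  assumes ob: "x \<in> Ob C" "y \<in> Ob C" and f: "f \<in> Hom C x y"
  shows "lam y \<cdot> f = f \<cdot> lam x"
proof (rule right_trace_eqI[OF ob])
  note lx = lam_hom[OF ob(1)] and ly = lam_hom[OF ob(2)]
  show "lam y \<cdot> f \<in> Hom C x y" "f \<cdot> lam x \<in> Hom C x y"
    by (rule comp_hom[OF ob(1,2,2) f ly] comp_hom[OF ob(1,1,2) lx f])+
  fix v assume v: "v \<in> Hom C y x"
  note vl = comp_hom[OF ob(2,2,1) ly v] and fv = comp_hom[OF ob(2,1,2) v f] and vf = comp_hom[OF ob(1,2,1) f v]
  have "rt x (v \<cdot> lam y \<cdot> f) = rt x ((v \<cdot> lam y) \<cdot> f)"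
    using comp_assoc[OF ob(1,2,2,1) f ly v] by simp
  also have "\<dots> = rt y (f \<cdot> v \<cdot> lam y)"
    by (rule trace_cyclic(2)[OF ob f vl, symmetric])
  also have "\<dots> = lt y (f \<cdot> v)"
    using comp_assoc[OF ob(2,2,1,2) ly v f] lt_eq_rt_lam[OF ob(2) fv] by simp
  also have "\<dots> = lt x (v \<cdot> f)"
    by (rule trace_cyclic(1)[OF ob f v])
  also have "\<dots> = rt x (v \<cdot> f \<cdot> lam x)"
    using comp_assoc[OF ob(1,1,2,1) lx f v] lt_eq_rt_lam[OF ob(1) vf] by simp
  finally show "rt x (v \<cdot> lam y \<cdot> f) = rt x (v \<cdot> f \<cdot> lam x)" .
qed

definition Lam :: "'a \<Rightarrow> ('a, 'b) arrow" where
  "Lam x = Arrow x (lam x) x"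

lemma Lam_sel [simp]: "src (Lam x) = x" "trg (Lam x) = x" "mor (Lam x) = lam x" "x \<in> Ob C \<Longrightarrow> arr (Lam x)"
  by (simp_all add: Lam_def lam_hom)

lemma TR_Lam:
  assumes f: "arr f" "src f = c" "trg f = c"
  shows "TR (Lam c \<bullet> f) = TL f"
proof (rule arrow.expand)
  have c: "c \<in> Ob C" and fh: "mor f \<in> Hom C c c"
    using f arr_ob[OF f(1)] by (auto simp: arr_in_hom)
  have "f = Arrow c (mor f) c" using f by (cases f) simp
  moreover from this have "Lam c \<bullet> f = Arrow c (lam c \<cdot> mor f) c"
    by (metis Lam_sel(2,3) acomp_def arrow.sel(1))
  ultimately show "src (TR (Lam c \<bullet> f)) = src (TL f) \<and> mor (TR (Lam c \<bullet> f)) = mor (TL f)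
      \<and> trg (TR (Lam c \<bullet> f)) = trg (TL f)"
    using lt_eq_rt_lam[OF c fh] trace_cyclic(2)[OF c c fh lam_hom[OF c]]
      left_trace_eq[OF c, of "mor f"] right_trace_eq[OF c, of "lam c \<cdot> mor f"] by simp
qed

text \<open>Strands are converted one at a time: \<open>x\<close> is closed on the left, the trace
  over \<open>y\<close> becomes a right trace at the cost of \<open>lam y\<close>, the two loops are
  interchanged, and the trace over \<open>x\<close> is converted at the cost of
  \<open>lam x\<close>.\<close>

lemma lam_tensor:
  assumes [simp]: "x \<in> Ob C" "y \<in> Ob C"
  shows "lam (x \<otimes> y) = lam x \<boxtimes> lam y"
proof (rule right_trace_eqI[of "x \<otimes> y" "x \<otimes> y"])
  show h: "lam (x \<otimes> y) \<in> Hom C (x \<otimes> y) (x \<otimes> y)" "lam x \<boxtimes> lam y \<in> Hom C (x \<otimes> y) (x \<otimes> y)"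
    by (simp_all add: lam_hom tensor_hom)
  fix v assume v: "v \<in> Hom C (x \<otimes> y) (x \<otimes> y)"
  define V where "V = Arrow (x \<otimes> y) v (x \<otimes> y)"
  have [simp]: "arr V" "src V = x \<otimes> y" "trg V = x \<otimes> y" using v by (simp_all add: V_def)
  let ?W = "(I x \<odot> Lam y) \<bullet> V"
  have "TR (Lam (x \<otimes> y) \<bullet> V) = TL V"
    by (rule TR_Lam) simp_all
  also have "\<dots> = TL (PL x y y V)"
    by (rule TL_tensor) simp_all
  also have "\<dots> = TR (Lam y \<bullet> PL x y y V)"
    by (rule TR_Lam[symmetric]) simp_all
  also have "Lam y \<bullet> PL x y y V = PL x y y ?W"
    using PL_natural[of x "Lam y" "I y" V y y y y] by simp
  also have "TR (PL x y y ?W) = TL (PR x x y ?W)"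
    by (rule TR_TL_swap) simp_all
  also have "\<dots> = TR (Lam x \<bullet> PR x x y ?W)"
    by (rule TR_Lam[symmetric]) simp_all
  also have "Lam x \<bullet> PR x x y ?W = PR x x y ((Lam x \<odot> I y) \<bullet> ?W)"
    by (rule PR_natural[symmetric]) simp_all
  also have "TR (PR x x y ((Lam x \<odot> I y) \<bullet> ?W)) = TR ((Lam x \<odot> I y) \<bullet> ?W)"
    by (rule TR_tensor[symmetric]) simp_all
  also have "(Lam x \<odot> I y) \<bullet> ?W = (Lam x \<odot> Lam y) \<bullet> V"
    by (rule comp_reduce1[OF tensor_left_last]) simp_all
  finally have "rt (x \<otimes> y) (lam (x \<otimes> y) \<cdot> v) = rt (x \<otimes> y) ((lam x \<boxtimes> lam y) \<cdot> v)"
    by (simp add: right_trace_eq acomp_def atensor_def V_def)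
  then show "rt (x \<otimes> y) (v \<cdot> lam (x \<otimes> y)) = rt (x \<otimes> y) (v \<cdot> (lam x \<boxtimes> lam y))"
    using trace_cyclic(2)[of "x \<otimes> y" "x \<otimes> y" v] v h by simp
qed simp_all

text \<open>By \<open>lam_tensor\<close> on \<open>\<one> \<otimes> \<one>\<close> it is idempotent,
  and an invertible idempotent is the identity.\<close>

lemma lam_unit: "lam \<one> = id \<one>"
proof -
  obtain m where m: "inverse_mor C \<one> \<one> (lam \<one>) m"
    by (rule lam_inverse[OF unit_ob])
  have "Lam \<one> = Lam \<one> \<odot> Lam \<one>"
    using lam_tensor[of \<one> \<one>] by (intro arrow.expand) simp
  also have "\<dots> = Lam \<one> \<bullet> Lam \<one>"
    using tensor_left_last[of "Lam \<one>" "Lam \<one>" \<one> \<one>] by simp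
  finally have "mor (Lam \<one>) = mor (Lam \<one> \<bullet> Lam \<one>)" by simp
  then have "m \<cdot> lam \<one> = m \<cdot> lam \<one> \<cdot> lam \<one>" by simp
  also have "\<dots> = (m \<cdot> lam \<one>) \<cdot> lam \<one>"
    using m comp_assoc[of \<one> \<one> \<one> \<one> "lam \<one>" "lam \<one>" m] by (simp add: inverse_mor_def)
  finally show ?thesis
    using m id_left[OF unit_ob unit_ob lam_hom[OF unit_ob]] by (simp add: inverse_mor_def)
qed

section \<open>Existence and uniqueness of the conjugate\<close>

definition conj_pivotal :: "'a \<Rightarrow> 'b" where
  "conj_pivotal = (\<lambda>x\<in>Ob C. a x \<cdot> lam x)"

lemma pivotal_structure_conj: "pivotal_structure C conj_pivotal"
  unfolding pivotal_structure_def
proof (intro conjI ballI)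
  have hom: "a x \<cdot> lam x \<in> Hom C x (rd (rd x))" if "x \<in> Ob C" for x
    using comp_hom[OF that that _ lam_hom[OF that] a_hom[OF that]] that by simp
  then show "conj_pivotal \<in> (\<Pi>\<^sub>E x\<in>Ob C. Hom C x (rd (rd x)))"
    by (simp add: conj_pivotal_def)
  fix x assume x[simp]: "x \<in> Ob C"
  have A: "conj_pivotal x = mor (A x \<bullet> Lam x)"
    by (simp add: conj_pivotal_def)
  obtain m where "inverse_mor C x x (lam x) m"
    by (rule lam_inverse[OF x])
  then obtain M where [simp]: "arr M" "src M = x" "trg M = x" and M: "M \<bullet> Lam x = I x" "Lam x \<bullet> M = I x"
    by (intro that[of "Arrow x m x"] arrow.expand) (auto simp: inverse_mor_def intro!: arrow.expand)
  obtain B where [simp]: "arr B" "src B = rd (rd x)" "trg B = x"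
    and B: "B \<bullet> A x = I x" "A x \<bullet> B = I (rd (rd x))"
    by (rule A_inverse[of x]) simp_all
  have "(M \<bullet> B) \<bullet> A x \<bullet> Lam x = I x" "(A x \<bullet> Lam x) \<bullet> M \<bullet> B = I (rd (rd x))"
    using comp_reduce1[OF B(1), of "Lam x"] comp_reduce1[OF M(2), of B] by (simp_all add: M B)
  then have "inverse_mor C x (rd (rd x)) (mor (A x \<bullet> Lam x)) (mor (M \<bullet> B))"
    unfolding inverse_mor_def by (metis arr_in_hom arr_comp arrow_sel(3,4,5,6) A_sel Lam_sel arr_A
        \<open>arr B\<close> \<open>arr M\<close> \<open>src B = _\<close> \<open>trg B = _\<close> \<open>src M = _\<close> \<open>trg M = _\<close> x)
  then show "iso_mor C x (rd (rd x)) (conj_pivotal x)"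
    unfolding iso_mor_def A by blast
  fix y assume y[simp]: "y \<in> Ob C"
  { fix f assume f: "f \<in> Hom C x y"
    let ?F = "Arrow x f y"
    have [simp]: "arr ?F" using f by simp
    have "Lam y \<bullet> ?F = ?F \<bullet> Lam x"
      using lam_natural[OF x y f] by (intro arrow.expand) simp
    then have "(A y \<bullet> Lam y) \<bullet> ?F = dual (dual ?F) \<bullet> A x \<bullet> Lam x"
      using comp_reduce[OF A_natural[of ?F], of "Lam x"] by simp
    then have "mor ((A y \<bullet> Lam y) \<bullet> ?F) = mor (dual (dual ?F) \<bullet> A x \<bullet> Lam x)"
      by (simp only:)
    then show "conj_pivotal y \<cdot> f = double_dual_mor C x y f \<cdot> conj_pivotal x"
      by (simp del: acomp_assoc add: conj_pivotal_def dual_def double_dual_mor_def) }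
  have "A (x \<otimes> y) \<bullet> (Lam x \<odot> Lam y) = dual (DTI x y) \<bullet> DT (rd y) (rd x) \<bullet> ((A x \<bullet> Lam x) \<odot> (A y \<bullet> Lam y))"
    by (simp add: A_tensor ainterchange)
  also have "\<dots> = (dual (DTI x y) \<bullet> DT (rd y) (rd x)) \<bullet> ((A x \<bullet> Lam x) \<odot> (A y \<bullet> Lam y))"
    by simp
  finally have "mor (A (x \<otimes> y) \<bullet> (Lam x \<odot> Lam y))
      = mor ((dual (DTI x y) \<bullet> DT (rd y) (rd x)) \<bullet> ((A x \<bullet> Lam x) \<odot> (A y \<bullet> Lam y)))"
    by (rule arg_cong)
  then show "conj_pivotal (x \<otimes> y) = double_dual_tensor C x y \<cdot> (conj_pivotal x \<boxtimes> conj_pivotal y)"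
    by (simp del: acomp_assoc add: conj_pivotal_def lam_tensor dual_def double_dual_tensor_def mor_DT)
next
  show "conj_pivotal \<one> = double_dual_unit C"
    using pivotal id_right[OF unit_ob _ a_hom[OF unit_ob]]
    by (simp add: conj_pivotal_def lam_unit pivotal_structure_def)
qed

text \<open>In terms of traces this is the characterisation of \<open>lam\<close>, up to moving
  \<open>lam c\<close> to the other side of \<open>v\<close> by cyclicity.\<close>

lemma is_conjugate_conj: "is_conjugate C a conj_pivotal"
  unfolding is_conjugate_iff[OF pivotal_structure_conj]
proof (intro ballI)
  fix c v assume c: "c \<in> Ob C" and v: "v \<in> Hom C c c"
  have "right_trace C conj_pivotal c v = rt c (lam c \<cdot> v)"
    using c v comp_assoc[OF c c c _ v lam_hom[OF c] a_hom[OF c]]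
    by (simp add: right_trace_def conj_pivotal_def)
  then show "lt c v = right_trace C conj_pivotal c v"
    using lt_eq_rt_lam[OF c v] trace_cyclic(2)[OF c c v lam_hom[OF c]] by simp
qed

lemma conjugate_inverse_unique:
  assumes x: "x \<in> Ob C"
  shows "\<exists>!t. t \<in> Hom C x (ld (ld x)) \<and> conjugate_condition C a x t"
proof (rule ex_ex1I)
  show "\<exists>t. t \<in> Hom C x (ld (ld x)) \<and> conjugate_condition C a x t"
    using is_conjugate_conj pivotal_inverse[OF pivotal_structure_conj x] x
    unfolding is_conjugate_def inverse_mor_def by blast
qed (use conjugate_condition_unique[OF x] in blast)

lemma conjugate_unique: "\<exists>!b. is_conjugate C a b"
proof (rule ex_ex1I)
  show "\<exists>b. is_conjugate C a b"
    using is_conjugate_conj by blast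
  fix b b' assume b: "is_conjugate C a b" and b': "is_conjugate C a b'"
  then have piv: "pivotal_structure C b" "pivotal_structure C b'"
    by (simp_all add: is_conjugate_def)
  show "b = b'"
  proof (rule PiE_ext)
    show "b \<in> (\<Pi>\<^sub>E x\<in>Ob C. Hom C x (rd (rd x)))" "b' \<in> (\<Pi>\<^sub>E x\<in>Ob C. Hom C x (rd (rd x)))"
      using piv by (simp_all add: pivotal_structure_def)
    fix z assume z: "z \<in> Ob C"
    \<comment> \<open>The condition only speaks about components at double left duals; with this
      \<open>x\<close>, the component at \<open>z\<close> is one of them.\<close>
    define x where "x = rd (rd z)"
    have x: "x \<in> Ob C" and zx: "ld (ld x) = z" using z by (simp_all add: x_def)
    note inv = pivotal_inverse[OF piv(1) x] pivotal_inverse[OF piv(2) x]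
    have "inv_mor C z x (b z) = inv_mor C z x (b' z)"
      using b b' x inv conjugate_condition_unique[OF x]
      unfolding is_conjugate_def zx inverse_mor_def by (metis zx)
    then show "b z = b' z"
      using inv[THEN inverse_mor_sym] inverse_mor_unique[OF x z] unfolding zx by metis
  qed
qed

section \<open>Traces and dimensions of the conjugate\<close>

lemma is_conjugate_conjugate: "is_conjugate C a (conjugate C a)"
  unfolding conjugate_def by (rule theI'[OF conjugate_unique])

lemma conjugate_eqI: "is_conjugate C a b \<Longrightarrow> conjugate C a = b"
  using is_conjugate_conjugate conjugate_unique by blast

lemma pivotal_conjugate: "pivotal_structure C (conjugate C a)"
  using is_conjugate_conjugate by (simp add: is_conjugate_def)

lemma right_trace_conjugate:
  "\<lbrakk>c \<in> Ob C; v \<in> Hom C c c\<rbrakk> \<Longrightarrow> right_trace C (conjugate C a) c v = lt c v"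
  using is_conjugate_conjugate is_conjugate_iff[OF pivotal_conjugate] by simp

text \<open>Write \<open>v\<close> as the transpose of \<open>f\<close>. Its left trace for the
  conjugate is the right trace of \<open>f\<close> for the conjugate, hence the left trace of
  \<open>f\<close> for \<open>a\<close>. Two transpositions preserve that trace, and
  \<open>dual (dual f)\<close> is the transpose of \<open>v\<close>, whose left trace is the right
  trace of \<open>v\<close>.\<close>

lemma left_trace_conjugate:
  assumes c: "c \<in> Ob C" and v: "v \<in> Hom C c c"
  shows "left_trace C (conjugate C a) c v = rt c v"
proof -
  interpret b: pivotal_category C "conjugate C a"
    using pivotal_conjugate by unfold_locales
  obtain f where f: "arr f" "src f = ld c" "trg f = ld c" "dual f = Arrow c v c"
    using dual_surj[of "Arrow c v c" "ld c" "ld c"] c v by auto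
  have fh: "mor f \<in> Hom C (ld c) (ld c)" "f = Arrow (ld c) (mor f) (ld c)"
    using f by (auto simp: arr_in_hom intro: arrow.expand)
  have "left_trace C (conjugate C a) c v = mor (b.TR f)"
    using b.TL_dual[OF f(1-3)] f(4) b.left_trace_eq[OF c] by simp
  also have "\<dots> = mor (TL f)"
    using right_trace_conjugate[OF _ fh(1)] b.right_trace_eq[of "ld c" "mor f"]
      left_trace_eq[of "ld c" "mor f"] fh(2) c by simp
  also have "\<dots> = mor (TL (dual (dual f)))"
    by (simp add: TL_dual_dual[OF f(1-3)])
  also have "\<dots> = rt c v"
    using TL_dual[of "Arrow c v c" c] c v f(4) by (simp add: right_trace_eq)
  finally show ?thesis .
qed

text \<open>For identities the left closure of \<open>x\<close> is literally the right closure of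
  \<open>ld x\<close>, so a dimension for the conjugate is already one of its right traces.\<close>

lemma dimension_conjugate:
  assumes x: "x \<in> Ob C"
  shows "dimension C (conjugate C a) x = dimension C a (ld x)"
proof -
  interpret b: pivotal_category C "conjugate C a"
    using pivotal_conjugate by unfold_locales
  have "dimension C (conjugate C a) x = right_trace C (conjugate C a) (ld x) (id (ld x))"
    using x id_right[OF dual_ob(2)[OF x] _ b.a_hom[OF dual_ob(2)[OF x]]] coev_ldual[OF x]
    by (simp add: dimension_def left_trace_def right_trace_def)
  then show ?thesis
    using x right_trace_conjugate[of "ld x"] by (simp add: id_hom dimension_def)
qed

lemma conjugate_eq_self_iff: "conjugate C a = a \<longleftrightarrow> spherical C a"
proof -
  have "conjugate C a = a \<longleftrightarrow> is_conjugate C a a"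
    using conjugate_eqI is_conjugate_conjugate by metis
  also have "\<dots> \<longleftrightarrow> spherical C a"
    by (simp add: is_conjugate_iff[OF pivotal] spherical_def)
  finally show ?thesis .
qed

text \<open>The left trace of the conjugate is the right trace of \<open>a\<close>, so
  \<open>a\<close> meets the trace criterion for being the conjugate of its conjugate.\<close>

lemma conjugate_conjugate: "conjugate C (conjugate C a) = a"
proof -
  interpret b: pivotal_fusion_category C "conjugate C a"
    using pivotal_conjugate by unfold_locales
  show ?thesis
    by (rule b.conjugate_eqI) (simp add: b.is_conjugate_iff[OF pivotal] left_trace_conjugate)
qed

end

theorem theorem4p7:
  fixes C :: "('o, 'm::ab_group_add) tensor_data" (structure)
    and a :: "'o \<Rightarrow> 'm"
  assumes "fusion_category C"
    and "pivotal_structure C a"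
  shows
    "((\<exists>!b. is_conjugate C a b) \<and>
      (\<forall>x\<in>Ob C. \<exists>!t. t \<in> Hom C x (ld (ld x)) \<and> conjugate_condition C a x t))
     \<and> (\<forall>x\<in>Ob C. dimension C (conjugate C a) x = dimension C a (ld x))
     \<and> (conjugate C a = a \<longleftrightarrow> spherical C a)
     \<and> conjugate C (conjugate C a) = a"
proof -
  interpret fusion_category C by (rule assms)
  interpret pivotal_fusion_category C a
    using assms(2) by unfold_locales
  show ?thesis
    using conjugate_unique conjugate_inverse_unique dimension_conjugate conjugate_eq_self_iff
      conjugate_conjugate by blast
qed

end
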